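(* Let $X=\{X_t\}_{t\ge0}$ be a Lévy process in $\mathbb{R}^n$ with $X_0=0$ and characteristic triplet $(c,Q,\nu)$, where $c\in\mathbb{R}^n$, $Q\in\mathbb{R}^{n\times n}$ is a nonnegative symmetric matrix and $\nu$ is a measure on $\mathbb{R}^n\setminus\{0\}$ with $\int_{\mathbb{R}^n\setminus\{0\}}(|x|^2\wedge1)\,\nu(dx)<\infty$. Let $Z=\{Z_t\}_{t\ge0}$ be an additive subordinator, independent of $X$, with Laplace exponent $\log \mathbf{E}[e^{-uZ_t}]=\int_0^t\psi_s(u)\,ds$ for $u\in\mathbb{C}$ with $\Re(u)\ge 0$, where $$\psi_s(u)=-u\beta(s)+\int_{(0,\infty)}(e^{-ur}-1)\,g(s,r)\,dr ,$$ $\beta:\mathbb{R}_+\to\mathbb{R}_+$ and $g:\mathbb{R}_+\times\mathbb{R}_+\to\mathbb{R}_+$ are continuous, and $\int_{(0,\infty)}(1\wedge r)\,g(s,r)\,dr<\infty$ for all $s\in\mathbb{R}_+$. Let $Y_t:=X_{Z_t}$ for $t\ge 0$. Then $Y=\{Y_t\}_{t\ge0}$ is an additive process with càdlàg paths, with jump measure (on $\mathbb{R}^n\setminus\{0\}$) $$\widetilde\nu_s(dx)=\beta(s)\,\nu(dx)+\int_{(0,\infty)}\mathbf{P}(X_r\in dx)\,g(s,r)\,dr,$$ nonnegative symmetric matrix $\widetilde Q_s=\beta(s)Q$, drift $$\widetilde c_s=\beta(s)c+\int_{(0,\infty)}\mathbf{E}\big[X_r\mathbf{I}_{\{|X_r|\le1\}}\big]\,g(s,r)\,dr,$$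 and characteristic exponent $\overline\Psi_t(u)=\int_0^t\Psi_s(u)\,ds$, i.e. $\mathbf{E}[e^{\mathrm{i}u\cdot Y_t}]=e^{\overline\Psi_t(u)}$ for all $u\in\mathbb{R}^n$ and $t\ge 0$, where $$\Psi_s(u)=\mathrm{i}u\cdot\widetilde c_s-\frac12u\cdot\widetilde Q_su+\int_{\mathbb{R}^n\setminus\{0\}}\Big[e^{\mathrm{i}u\cdot x}-1-\mathrm{i}(u\cdot x)\mathbf{I}_{\{|x|\le1\}}\Big]\,\widetilde\nu_s(dx).$$
   Context: $\mathbb{R}_+=[0,\infty)$, $n\in\mathbb{N}$, and $\mathbf{I}_A$ denotes the indicator of $A$. The characteristic triplet $(c,Q,\nu)$ of $X$ is taken with respect to the truncation function $x\mathbf{I}_{\{|x|\le1\}}$: $\mathbf{E}[e^{\mathrm{i}u\cdot X_t}]=e^{t\Psi_X(u)}$ with $$\Psi_X(u)=\mathrm{i}u\cdot c-\tfrac12u\cdot Qu+\int_{\mathbb{R}^n\setminus\{0\}}\big[e^{\mathrm{i}u\cdot x}-1-\mathrm{i}(u\cdot x)\mathbf{I}_{\{|x|\le1\}}\big]\nu(dx),\qquad u\in\mathbb{R}^n.$$ Lévy processes are taken with càdlàg paths. An additive process is a càdlàg process with independent, possibly nonstationary, increments; an additive subordinator is an additive process in $\mathbb{R}_+$ with nondecreasing paths. The value $Z_0=0$ a.s. is implied by the formula for the Laplace exponent. The jump measure, symmetric matrix and drift of $Y$ at time $s$ are the (time-dependent) characteristics appearing in the displayed formula for $\Psi_s$.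 *)

theory Defs
  imports "HOL-Probability.Probability"
begin

text \<open>
  Processes are indexed by the type of reals, but only times \<open>t \<ge> 0\<close> are ever constrained.
  Path properties are required for every outcome in the sample space, not just almost surely.
\<close>

definition cadlag :: "(real \<Rightarrow> 'b::topological_space) \<Rightarrow> bool" where
  "cadlag f \<longleftrightarrow>
     (\<forall>t\<ge>0. (f \<longlongrightarrow> f t) (at_right t)) \<and>
     (\<forall>t>0. \<exists>l. (f \<longlongrightarrow> l) (at_left t))"

definition independent_increments ::
    "'w measure \<Rightarrow> (real \<Rightarrow> 'w \<Rightarrow> 'b::euclidean_space) \<Rightarrow> bool" where
  "independent_increments M X \<longleftrightarrow>
     (\<forall>(k::nat) (t::nat \<Rightarrow> real). 0 \<le> t 0 \<longrightarrow> (\<forall>i<k. t i < t (Suc i)) \<longrightarrow>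
        prob_space.indep_vars M (\<lambda>_. borel) (\<lambda>i \<omega>. X (t (Suc i)) \<omega> - X (t i) \<omega>) {..<k})"

definition stationary_increments ::
    "'w measure \<Rightarrow> (real \<Rightarrow> 'w \<Rightarrow> 'b::euclidean_space) \<Rightarrow> bool" where
  "stationary_increments M X \<longleftrightarrow>
     (\<forall>t\<ge>0. \<forall>h\<ge>0. distr M borel (\<lambda>\<omega>. X (t + h) \<omega> - X t \<omega>)
                    = distr M borel (\<lambda>\<omega>. X h \<omega> - X 0 \<omega>))"

definition additive_process ::
    "'w measure \<Rightarrow> (real \<Rightarrow> 'w \<Rightarrow> 'b::euclidean_space) \<Rightarrow> bool" where
  "additive_process M X \<longleftrightarrow>
     (\<forall>t\<ge>0. X t \<in> borel_measurable M) \<and>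
     (\<forall>\<omega>\<in>space M. cadlag (\<lambda>t. X t \<omega>)) \<and>
     independent_increments M X"

definition levy_process ::
    "'w measure \<Rightarrow> (real \<Rightarrow> 'w \<Rightarrow> 'b::euclidean_space) \<Rightarrow> bool" where
  "levy_process M X \<longleftrightarrow>
     additive_process M X \<and> stationary_increments M X \<and> (AE \<omega> in M. X 0 \<omega> = 0)"

definition additive_subordinator :: "'w measure \<Rightarrow> (real \<Rightarrow> 'w \<Rightarrow> real) \<Rightarrow> bool" where
  "additive_subordinator M Z \<longleftrightarrow>
     additive_process M Z \<and>
     (\<forall>\<omega>\<in>space M. (\<forall>t\<ge>0. 0 \<le> Z t \<omega>) \<and> mono_on {0..} (\<lambda>t. Z t \<omega>))"

definition process_sigma ::
    "'w measure \<Rightarrow> (real \<Rightarrow> 'w \<Rightarrow> 'b::topological_space) \<Rightarrow> 'w set set" where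
  "process_sigma M X =
     sigma_sets (space M) (\<Union>t\<in>{0..}. {X t -` A \<inter> space M | A. A \<in> sets borel})"

text \<open>
  Stated through generated sigma-algebras because \<open>indep_var\<close> would force both processes
  to take values in the same type.
\<close>

definition independent_processes ::
    "'w measure \<Rightarrow> (real \<Rightarrow> 'w \<Rightarrow> 'b::topological_space) \<Rightarrow>
     (real \<Rightarrow> 'w \<Rightarrow> 'c::topological_space) \<Rightarrow> bool" where
  "independent_processes M X Z \<longleftrightarrow>
     prob_space.indep_set M (process_sigma M X) (process_sigma M Z)"

definition time_change :: "(real \<Rightarrow> 'w \<Rightarrow> 'b) \<Rightarrow> (real \<Rightarrow> 'w \<Rightarrow> real) \<Rightarrow> real \<Rightarrow> 'w \<Rightarrow> 'b" where
  "time_change X Z t \<omega> = X (Z t \<omega>) \<omega>"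

definition nonneg_symmetric :: "real^'n^'n \<Rightarrow> bool" where
  "nonneg_symmetric Q \<longleftrightarrow> transpose Q = Q \<and> (\<forall>v. 0 \<le> v \<bullet> (Q *v v))"

abbreviation punctured_borel :: "(real^'n) measure" where
  "punctured_borel \<equiv> restrict_space borel (- {0})"

definition levy_measure :: "(real^'n) measure \<Rightarrow> bool" where
  "levy_measure \<nu> \<longleftrightarrow>
     sets \<nu> = sets punctured_borel \<and>
     (\<integral>\<^sup>+ x. ennreal (min ((norm x)\<^sup>2) 1) \<partial>\<nu>) < \<infinity>"

definition levy_exponent ::
    "real^'n \<Rightarrow> real^'n^'n \<Rightarrow> (real^'n) measure \<Rightarrow> real^'n \<Rightarrow> complex" where
  "levy_exponent c Q \<nu> u =
     \<i> * complex_of_real (u \<bullet> c) - 1/2 * complex_of_real (u \<bullet> (Q *v u))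
     + (LINT x|\<nu>. iexp (u \<bullet> x) - 1
          - \<i> * complex_of_real (u \<bullet> x) * indicator {x. norm x \<le> 1} x)"

definition has_levy_triplet ::
    "'w measure \<Rightarrow> (real \<Rightarrow> 'w \<Rightarrow> real^'n) \<Rightarrow>
     real^'n \<Rightarrow> real^'n^'n \<Rightarrow> (real^'n) measure \<Rightarrow> bool" where
  "has_levy_triplet M X c Q \<nu> \<longleftrightarrow>
     nonneg_symmetric Q \<and> levy_measure \<nu> \<and>
     (\<forall>t\<ge>0. \<forall>u. (LINT \<omega>|M. iexp (u \<bullet> X t \<omega>)) = exp (complex_of_real t * levy_exponent c Q \<nu> u))"

definition subordinator_exponent ::
    "(real \<Rightarrow> real) \<Rightarrow> (real \<Rightarrow> real \<Rightarrow> real) \<Rightarrow> real \<Rightarrow> complex \<Rightarrow> complex" where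
  "subordinator_exponent \<beta> g s u =
     - u * complex_of_real (\<beta> s)
     + (LINT r:{0<..}|lborel. (exp (- u * complex_of_real r) - 1) * complex_of_real (g s r))"

text \<open>
  The Laplace exponent \<open>\<integral>\<^sub>0\<^sup>t \<psi> s u ds\<close> is the continuous logarithm of the
  Laplace transform, not the principal branch \<open>Ln\<close>; hence the exponential form. Integrability
  has to be required explicitly, since the Bochner integral of a non-integrable function is 0.
\<close>

definition has_laplace_exponent ::
    "'w measure \<Rightarrow> (real \<Rightarrow> 'w \<Rightarrow> real) \<Rightarrow> (real \<Rightarrow> complex \<Rightarrow> complex) \<Rightarrow> bool" where
  "has_laplace_exponent M Z \<psi> \<longleftrightarrow>
     (\<forall>t\<ge>0. \<forall>u. 0 \<le> Re u \<longrightarrow>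
        set_integrable lborel {0..t} (\<lambda>s. \<psi> s u) \<and>
        (LINT \<omega>|M. exp (- u * complex_of_real (Z t \<omega>))) = exp (LINT s:{0..t}|lborel. \<psi> s u))"

definition has_characteristic_exponent ::
    "'w measure \<Rightarrow> (real \<Rightarrow> 'w \<Rightarrow> real^'n) \<Rightarrow> (real \<Rightarrow> real^'n \<Rightarrow> complex) \<Rightarrow> bool" where
  "has_characteristic_exponent M Y \<Psi> \<longleftrightarrow>
     (\<forall>t\<ge>0. \<forall>u.
        set_integrable lborel {0..t} (\<lambda>s. \<Psi> s u) \<and>
        (LINT \<omega>|M. iexp (u \<bullet> Y t \<omega>)) = exp (LINT s:{0..t}|lborel. \<Psi> s u))"

definition subordinate_mass ::
    "'w measure \<Rightarrow> (real \<Rightarrow> 'w \<Rightarrow> real^'n) \<Rightarrow> (real^'n) measure \<Rightarrow>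
     (real \<Rightarrow> real) \<Rightarrow> (real \<Rightarrow> real \<Rightarrow> real) \<Rightarrow> real \<Rightarrow> (real^'n) set \<Rightarrow> ennreal" where
  "subordinate_mass M X \<nu> \<beta> g s A =
     ennreal (\<beta> s) * emeasure \<nu> A
     + (\<integral>\<^sup>+ r\<in>{0<..}. emeasure M {\<omega> \<in> space M. X r \<omega> \<in> A} * ennreal (g s r) \<partial>lborel)"

text \<open>
  \<open>measure_of\<close> collapses to the zero measure on set functions that are not countably additive,
  so \<open>emeasure (subordinate_jump_measure \<dots>) A = subordinate_mass \<dots> A\<close> needs a proof.
\<close>

definition subordinate_jump_measure ::
    "'w measure \<Rightarrow> (real \<Rightarrow> 'w \<Rightarrow> real^'n) \<Rightarrow> (real^'n) measure \<Rightarrow>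
     (real \<Rightarrow> real) \<Rightarrow> (real \<Rightarrow> real \<Rightarrow> real) \<Rightarrow> real \<Rightarrow> (real^'n) measure" where
  "subordinate_jump_measure M X \<nu> \<beta> g s =
     measure_of (- {0}) (sets punctured_borel) (subordinate_mass M X \<nu> \<beta> g s)"

definition truncated_mean :: "'w measure \<Rightarrow> ('w \<Rightarrow> real^'n) \<Rightarrow> real^'n" where
  "truncated_mean M V = (LINT \<omega>|M. indicator {x. norm x \<le> 1} (V \<omega>) *\<^sub>R V \<omega>)"

definition subordinate_drift ::
    "'w measure \<Rightarrow> (real \<Rightarrow> 'w \<Rightarrow> real^'n) \<Rightarrow> real^'n \<Rightarrow>
     (real \<Rightarrow> real) \<Rightarrow> (real \<Rightarrow> real \<Rightarrow> real) \<Rightarrow> real \<Rightarrow> real^'n" where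
  "subordinate_drift M X c \<beta> g s =
     \<beta> s *\<^sub>R c + (LINT r:{0<..}|lborel. g s r *\<^sub>R truncated_mean M (X r))"

end

theory Submission
  imports Defs
begin

text \<open>
  Since \<open>X\<close> and \<open>Z\<close> are independent, \<open>Z\<close> may be frozen. Along a frozen nondecreasing time
  path the increments of \<open>X\<close> are independent with laws depending only on the time increments, so
  the joint law of increments of \<open>Y\<close> is a product integrated against the increments of \<open>Z\<close>,
  which are themselves independent. In the same way \<open>E exp (i u Y\<^sub>t) = E exp (\<Psi> u * Z\<^sub>t)\<close>, which is
  the Laplace transform of \<open>Z\<^sub>t\<close> at \<open>- \<Psi> u\<close>, a point of the right half-plane because
  characteristic functions are bounded by 1. It remains to recognise the Laplace exponent at
  \<open>- \<Psi> u\<close> as the exponent of the subordinated triplet: integrating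
  \<open>exp (r * \<Psi> u) - 1 = E h (X\<^sub>r) + i u E [X\<^sub>r; norm X\<^sub>r \<le> 1]\<close>, with \<open>h\<close> the compensated integrand of
  the Levy-Khintchine formula, against \<open>g s r dr\<close>. The two summands are separately integrable
  because \<open>E (min (norm X\<^sub>r ^ 2) 1)\<close> and the truncated mean are \<open>O(min 1 r)\<close>, which is read off
  from \<open>norm (exp (r * \<Psi> u) - 1) \<le> r * norm (\<Psi> u)\<close> and the quadratic growth of \<open>\<Psi>\<close> without using the
  path decomposition of \<open>X\<close>.
\<close>

section \<open>Sums of measures\<close>

text \<open>Both sides are additive and continuous along increasing sequences in \<open>f\<close>,
  so agreement on indicators propagates. \<open>N\<close> enters only through its values on sets;
  this suits the jump measure, which is built by \<open>measure_of\<close>.\<close>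

lemma nn_integral_measure_add:
  assumes sets: "sets N1 = sets N" "sets N2 = sets N"
    and add: "\<And>A. A \<in> sets N \<Longrightarrow> emeasure N A = emeasure N1 A + emeasure N2 A"
    and f: "f \<in> borel_measurable N"
  shows "(\<integral>\<^sup>+x. f x \<partial>N) = (\<integral>\<^sup>+x. f x \<partial>N1) + (\<integral>\<^sup>+x. f x \<partial>N2)"
  using f
proof (induction rule: borel_measurable_induct)
  note [measurable_cong] = sets
  note sp = sets_eq_imp_space_eq[OF sets(1)] sets_eq_imp_space_eq[OF sets(2)]
  {
    case (cong f g)
    then have "integral\<^sup>N N' f = integral\<^sup>N N' g" if "space N' = space N" for N'
      using that by (intro nn_integral_cong) auto
    with cong sp show ?case by simp
  next
    case (set A)
    then show ?case using sets add by (simp add: nn_integral_indicator)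
  next
    case (mult u c)
    then have [measurable]: "u \<in> borel_measurable N" by simp
    from mult show ?case by (simp add: nn_integral_cmult distrib_left)
  next
    case (add u v)
    then have [measurable]: "u \<in> borel_measurable N" "v \<in> borel_measurable N" by simp_all
    from add show ?case by (simp add: nn_integral_add algebra_simps)
  next
    case (seq U)
    then have [measurable]: "\<And>i. U i \<in> borel_measurable N" by simp
    have *: "integral\<^sup>N N' (\<lambda>x. (SUP i. U i) x) = (SUP i. integral\<^sup>N N' (U i))"
      if [measurable_cong]: "sets N' = sets N" for N'
      unfolding SUP_apply using seq by (intro nn_integral_monotone_convergence_SUP) auto
    have inc: "incseq (\<lambda>i. integral\<^sup>N N' (U i))" for N'
      using seq(3) by (auto simp: mono_def le_fun_def intro!: nn_integral_mono)
    show ?case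
      using * sets seq by (simp add: ennreal_SUP_add[OF inc inc])
  }
qed

text \<open>Additivity of the integral of \<open>norm f\<close> makes integrability under
  \<open>N\<close> equivalent to integrability under both summands; induction over integrable
  functions then applies to all three measures at once.\<close>

lemma integral_measure_add:
  fixes f :: "'a \<Rightarrow> 'b::{banach, second_countable_topology}"
  assumes sets: "sets N1 = sets N" "sets N2 = sets N"
    and add: "\<And>A. A \<in> sets N \<Longrightarrow> emeasure N A = emeasure N1 A + emeasure N2 A"
    and f: "integrable N1 f" "integrable N2 f"
  shows "(\<integral>x. f x \<partial>N) = (\<integral>x. f x \<partial>N1) + (\<integral>x. f x \<partial>N2)"
proof -
  note [measurable_cong] = sets
  have int_iff: "integrable N f \<longleftrightarrow> integrable N1 f \<and> integrable N2 f" for f :: "'a \<Rightarrow> 'b"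
  proof -
    have "f \<in> borel_measurable N \<Longrightarrow> (\<integral>\<^sup>+x. norm (f x) \<partial>N) = (\<integral>\<^sup>+x. norm (f x) \<partial>N1) + (\<integral>\<^sup>+x. norm (f x) \<partial>N2)"
      by (intro nn_integral_measure_add sets add) auto
    then show ?thesis
      unfolding integrable_iff_bounded measurable_cong_sets[OF sets(1) refl] measurable_cong_sets[OF sets(2) refl]
      by (auto simp: ennreal_add_eq_top less_top)
  qed
  have "integrable N f" using f int_iff by simp
  then show ?thesis
  proof (induction rule: integrable_induct)
    case (base A c)
    then have "emeasure N1 A < \<infinity>" "emeasure N2 A < \<infinity>" using add[of A] by (auto simp: ennreal_add_eq_top less_top)
    with base sets add[of A] show ?case
      by (simp add: measure_def enn2real_plus scaleR_add_left)
  next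
    case (add f g)
    then show ?case using int_iff by simp
  next
    case (lim f s)
    \<comment> \<open>The approximants supplied by \<open>integrable_induct\<close> satisfy
      \<open>norm (s i x) \<le> 2 * norm (f x)\<close>, which gives the dominating function for each
      measure.\<close>
    have *: "(\<lambda>i. integral\<^sup>L N' (s i)) \<longlonglongrightarrow> integral\<^sup>L N' f"
      if "sets N' = sets N" "\<And>i. integrable N' (s i)" "integrable N' f" for N'
      using lim that sets_eq_imp_space_eq[OF that(1)]
      by (intro integral_dominated_convergence[where w="\<lambda>x. 2 * norm (f x)"]) auto
    have "(\<lambda>i. integral\<^sup>L N (s i)) \<longlonglongrightarrow> integral\<^sup>L N1 f + integral\<^sup>L N2 f"
      unfolding lim using lim int_iff sets by (intro tendsto_add *) auto
    moreover have "(\<lambda>i. integral\<^sup>L N (s i)) \<longlonglongrightarrow> integral\<^sup>L N f"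
      using lim by (intro *) auto
    ultimately show ?case by (rule LIMSEQ_unique[symmetric])
  qed
qed

section \<open>Cadlag paths and frozen processes\<close>

text \<open>From the right, \<open>z\<close> tends to \<open>z t\<close> through values at least
  \<open>z t\<close>, where \<open>x\<close> is continuous. From the left, with \<open>l\<close> the
  left limit of \<open>z\<close>, either \<open>z\<close> reaches \<open>l\<close> before
  \<open>t\<close> and the composition is eventually constant, or \<open>z\<close> approaches
  \<open>l\<close> strictly from below and the left limit of \<open>x\<close> at \<open>l\<close> is
  inherited.\<close>

lemma cadlag_compose_mono:
  fixes x :: "real \<Rightarrow> 'b::topological_space" and z :: "real \<Rightarrow> real"
  assumes x: "cadlag x" and z: "cadlag z" and mono: "mono_on {0..} z" and nn: "\<And>t. 0 \<le> t \<Longrightarrow> 0 \<le> z t"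
  shows "cadlag (\<lambda>t. x (z t))"
  unfolding cadlag_def
proof (intro conjI allI impI)
  fix t :: real assume t: "0 \<le> t"
  have "continuous (at (z t) within {z t..}) x"
    using x nn[OF t] unfolding cadlag_def continuous_within by (simp add: at_within_Ici_at_right)
  moreover have "eventually (\<lambda>s. z s \<in> {z t..}) (at_right t)"
    using eventually_at_right_less[of t]
    by eventually_elim (use t in \<open>auto intro!: mono_onD[OF mono]\<close>)
  moreover have "(z \<longlongrightarrow> z t) (at_right t)" using z t by (auto simp: cadlag_def)
  ultimately show "((\<lambda>s. x (z s)) \<longlongrightarrow> x (z t)) (at_right t)"
    by (rule continuous_within_tendsto_compose)
next
  fix t :: real assume t: "0 < t"
  then obtain l where l: "(z \<longlongrightarrow> l) (at_left t)" using z by (auto simp: cadlag_def)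
  have le: "z s \<le> l" if s: "0 \<le> s" "s < t" for s
  proof (rule tendsto_lowerbound[OF l])
    show "eventually (\<lambda>r. z s \<le> z r) (at_left t)"
      using eventually_at_left_real[OF s(2)]
      by eventually_elim (use s in \<open>auto intro!: mono_onD[OF mono]\<close>)
  qed simp
  show "\<exists>l'. ((\<lambda>s. x (z s)) \<longlongrightarrow> l') (at_left t)"
  proof (cases "\<exists>s. 0 \<le> s \<and> s < t \<and> z s = l")
    case True
    then obtain s where s: "0 \<le> s" "s < t" "z s = l" by auto
    have "eventually (\<lambda>r. x l = x (z r)) (at_left t)"
      using eventually_at_left_real[OF s(2)]
    proof eventually_elim
      case (elim r)
      then have "z s \<le> z r" using s by (intro mono_onD[OF mono]) auto
      then show ?case using s elim le[of r] by simp
    qed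
    then have "eventually (\<lambda>r. x (z r) = x l) (at_left t)" by eventually_elim simp
    then have "((\<lambda>s. x (z s)) \<longlongrightarrow> x l) (at_left t)" by (rule tendsto_eventually)
    then show ?thesis by blast
  next
    case False
    have lt: "z s < l" if "0 \<le> s" "s < t" for s using False le[OF that] that by force
    \<comment> \<open>\<open>cadlag\<close> provides left limits at positive times only, so
      positivity of \<open>l\<close> must be secured first.\<close>
    have "0 < l" using lt[of 0] nn[of 0] t by simp
    then obtain l' where "(x \<longlongrightarrow> l') (at_left l)" using x by (auto simp: cadlag_def)
    moreover have "filterlim z (at_left l) (at_left t)"
      unfolding filterlim_at
    proof (intro conjI l)
      show "eventually (\<lambda>s. z s \<in> {..<l} \<and> z s \<noteq> l) (at_left t)"
        using eventually_at_left_real[OF t]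
      proof eventually_elim
        case (elim s)
        then show ?case using lt[of s] by simp
      qed
    qed
    ultimately have "((\<lambda>s. x (z s)) \<longlongrightarrow> l') (at_left t)" by (rule filterlim_compose)
    then show ?thesis by blast
  qed
qed

section \<open>The sigma-algebra generated by a process: joint measurability and freezing\<close>

definition process_space ::
    "'w measure \<Rightarrow> (real \<Rightarrow> 'w \<Rightarrow> 'b::topological_space) \<Rightarrow> 'w measure" where
  "process_space M X =
     sigma (space M) (\<Union>t\<in>{0..}. {X t -` A \<inter> space M | A. A \<in> sets borel})"

lemma space_process_space [simp]: "space (process_space M X) = space M"
  unfolding process_space_def by (rule space_measure_of) auto

lemma sets_process_space: "sets (process_space M X) = process_sigma M X"
  unfolding process_space_def process_sigma_def by (rule sets_measure_of) auto

lemma measurable_process_space: "0 \<le> t \<Longrightarrow> X t \<in> borel_measurable (process_space M X)"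
  by (rule measurableI) (auto simp: sets_process_space process_sigma_def intro!: sigma_sets.Basic)

lemma ident_measurable_process_space:
  assumes "\<And>t. 0 \<le> t \<Longrightarrow> X t \<in> borel_measurable M"
  shows "(\<lambda>\<omega>. \<omega>) \<in> measurable M (process_space M X)"
  unfolding process_space_def using assms
  by (intro measurable_measure_of) (auto intro: measurable_sets)

text \<open>
  Right-continuity makes the process the pointwise limit of its values at the next point of the
  grid with mesh \<open>1 / (n + 1)\<close>. Clipping at 0 is needed since nothing is known
  about negative times.
\<close>

lemma cadlag_jointly_measurable:
  fixes X :: "real \<Rightarrow> 'w \<Rightarrow> 'b::metric_space"
  assumes "\<And>\<omega>. \<omega> \<in> space M \<Longrightarrow> cadlag (\<lambda>t. X t \<omega>)"
  shows "(\<lambda>(r, \<omega>). X (max 0 r) \<omega>) \<in> borel_measurable (borel \<Otimes>\<^sub>M process_space M X)"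
proof -
  \<comment> \<open>Floor plus one instead of the ceiling: the point stays strictly above
    \<open>max 0 r\<close> even when \<open>max 0 r\<close> lies on the grid, as convergence in
    \<open>at_right\<close> demands.\<close>
  define q :: "nat \<Rightarrow> real \<Rightarrow> real"
    where "q n r = (of_int \<lfloor>real (Suc n) * max 0 r\<rfloor> + 1) / real (Suc n)" for n r
  have gt: "max 0 r < q n r" for n r
  proof -
    have "max 0 r * real (Suc n) < of_int \<lfloor>real (Suc n) * max 0 r\<rfloor> + 1"
      by (metis floor_correct mult.commute of_int_1 of_int_add)
    then show ?thesis unfolding q_def by (subst pos_less_divide_eq) auto
  qed
  have le: "q n r \<le> max 0 r + 1 / real (Suc n)" for n r
  proof -
    have "real_of_int \<lfloor>real (Suc n) * max 0 r\<rfloor> \<le> real (Suc n) * max 0 r" by simp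
    then have "q n r \<le> (real (Suc n) * max 0 r + 1) / real (Suc n)"
      unfolding q_def by (intro divide_right_mono) auto
    then show ?thesis by (simp add: add_divide_distrib)
  qed
  have q_lim: "filterlim (\<lambda>n. q n r) (at_right (max 0 r)) sequentially" for r
    unfolding filterlim_at
  proof (intro conjI always_eventually allI)
    show "(\<lambda>n. q n r) \<longlonglongrightarrow> max 0 r"
    proof (rule tendsto_sandwich[of "\<lambda>_. max 0 r" _ _ "\<lambda>n. max 0 r + 1 / real (Suc n)"])
      show "(\<lambda>n. max 0 r + 1 / real (Suc n)) \<longlonglongrightarrow> max 0 r"
        using tendsto_add[OF tendsto_const LIMSEQ_inverse_real_of_nat, of "max 0 r"]
        by (simp add: inverse_eq_divide)
    qed (use gt le in \<open>auto intro!: always_eventually less_imp_le\<close>)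
  qed (use gt in \<open>simp, metis less_irrefl\<close>)
  show ?thesis
  proof (rule borel_measurable_LIMSEQ_metric)
    fix n
    \<comment> \<open>Clipping makes \<open>f i\<close> a process value at a nonnegative time, hence
      measurable, for every integer \<open>i\<close>, including the negative ones that
      \<open>k\<close> never attains. The integer index then allows gluing over countably many
      pieces.\<close>
    define f where "f i p = X (max 0 ((of_int i + 1) / real (Suc n))) (snd p)" for i :: int and p :: "real \<times> 'w"
    define k where "k p = \<lfloor>real (Suc n) * max 0 (fst p)\<rfloor>" for p :: "real \<times> 'w"
    have "(\<lambda>p. f (k p) p) \<in> borel_measurable (borel \<Otimes>\<^sub>M process_space M X)"
    proof (rule measurable_compose_countable)
      fix i
      show "f i \<in> borel_measurable (borel \<Otimes>\<^sub>M process_space M X)"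
        unfolding f_def by (rule measurable_compose[OF measurable_snd measurable_process_space]) simp
      show "k \<in> measurable (borel \<Otimes>\<^sub>M process_space M X) (count_space UNIV)"
        unfolding k_def by measurable
    qed
    moreover have "f (k p) p = X (q n (fst p)) (snd p)" for p
      using gt[of "fst p" n] unfolding f_def k_def q_def by (simp add: max_def)
    ultimately show "(\<lambda>p. X (q n (fst p)) (snd p)) \<in> borel_measurable (borel \<Otimes>\<^sub>M process_space M X)"
      by simp
  next
    fix p :: "real \<times> 'w" assume "p \<in> space (borel \<Otimes>\<^sub>M process_space M X)"
    then have "((\<lambda>t. X t (snd p)) \<longlongrightarrow> X (max 0 (fst p)) (snd p)) (at_right (max 0 (fst p)))"
      using assms by (auto simp: space_pair_measure cadlag_def)
    then show "(\<lambda>n. X (q n (fst p)) (snd p)) \<longlonglongrightarrow> (case p of (r, \<omega>) \<Rightarrow> X (max 0 r) \<omega>)"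
      unfolding case_prod_beta by (rule filterlim_compose[OF _ q_lim])
  qed
qed

text \<open>
  Independence says that the diagonal map sends \<open>M\<close> to the product of its restrictions to the
  two generated sigma-algebras, so one process may be frozen while integrating out the other.
\<close>

lemma (in prob_space) independent_processes_Fubini:
  fixes X :: "real \<Rightarrow> 'a \<Rightarrow> 'b::topological_space" and Z :: "real \<Rightarrow> 'a \<Rightarrow> 'c::topological_space"
    and f :: "'a \<times> 'a \<Rightarrow> 'd::{banach, second_countable_topology}"
  assumes indep: "independent_processes M X Z"
    and X: "\<And>t. 0 \<le> t \<Longrightarrow> X t \<in> borel_measurable M"
    and Z: "\<And>t. 0 \<le> t \<Longrightarrow> Z t \<in> borel_measurable M"
    and f[measurable]: "f \<in> borel_measurable (process_space M X \<Otimes>\<^sub>M process_space M Z)"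
    and bound: "\<And>p. norm (f p) \<le> B"
  shows "(\<integral>\<omega>. f (\<omega>, \<omega>) \<partial>M) = (\<integral>\<omega>'. (\<integral>\<omega>. f (\<omega>, \<omega>') \<partial>M) \<partial>M)"
proof -
  let ?X = "process_space M X" and ?Z = "process_space M Z"
  have id[measurable]: "(\<lambda>\<omega>. \<omega>) \<in> measurable M ?X" "(\<lambda>\<omega>. \<omega>) \<in> measurable M ?Z"
    using X Z by (auto intro: ident_measurable_process_space)
  interpret PX: prob_space "distr M ?X (\<lambda>\<omega>. \<omega>)" by (rule prob_space_distr) simp
  interpret PZ: prob_space "distr M ?Z (\<lambda>\<omega>. \<omega>)" by (rule prob_space_distr) simp
  interpret P: pair_prob_space "distr M ?X (\<lambda>\<omega>. \<omega>)" "distr M ?Z (\<lambda>\<omega>. \<omega>)" ..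
  \<comment> \<open>\<open>indep_var_eq\<close> phrases independence through sigma-algebras of
    preimages; for the identity map these are the generated sigma-algebras of
    \<open>independent_processes\<close>.\<close>
  have gen: "sigma_sets (space M) {(\<lambda>\<omega>. \<omega>) -` A \<inter> space M |A. A \<in> sets (process_space M W)}
      = process_sigma M W" for W :: "real \<Rightarrow> 'a \<Rightarrow> 'e::topological_space"
  proof -
    have "{(\<lambda>\<omega>. \<omega>) -` A \<inter> space M |A. A \<in> sets (process_space M W)} = sets (process_space M W)"
      using sets.sets_into_space[of _ "process_space M W"] by (auto simp: Int_absorb2 intro: exI)
    then show ?thesis
      using sets.sigma_sets_eq[of "process_space M W"] by (simp add: sets_process_space)
  qed
  have "indep_var ?X (\<lambda>\<omega>. \<omega>) ?Z (\<lambda>\<omega>. \<omega>)"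
    using indep unfolding indep_var_eq gen independent_processes_def by simp
  then have *: "distr M ?X (\<lambda>\<omega>. \<omega>) \<Otimes>\<^sub>M distr M ?Z (\<lambda>\<omega>. \<omega>) = distr M (?X \<Otimes>\<^sub>M ?Z) (\<lambda>\<omega>. (\<omega>, \<omega>))"
    unfolding indep_var_distribution_eq by simp
  have int: "integrable (distr M ?X (\<lambda>\<omega>. \<omega>) \<Otimes>\<^sub>M distr M ?Z (\<lambda>\<omega>. \<omega>)) (\<lambda>(x, y). f (x, y))"
    by (rule P.integrable_const_bound[where B=B]) (use bound in auto)
  have "(\<integral>\<omega>. f (\<omega>, \<omega>) \<partial>M) = integral\<^sup>L (distr M (?X \<Otimes>\<^sub>M ?Z) (\<lambda>\<omega>. (\<omega>, \<omega>))) f"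
    by (subst integral_distr) auto
  also have "\<dots> = (\<integral>\<omega>'. (\<integral>\<omega>. f (\<omega>, \<omega>') \<partial>distr M ?X (\<lambda>\<omega>. \<omega>)) \<partial>distr M ?Z (\<lambda>\<omega>. \<omega>))"
    unfolding *[symmetric] using P.integral_snd[OF int] by simp
  also have "\<dots> = (\<integral>\<omega>'. (\<integral>\<omega>. f (\<omega>, \<omega>') \<partial>distr M ?X (\<lambda>\<omega>. \<omega>)) \<partial>M)"
    by (subst integral_distr) auto
  also have "\<dots> = (\<integral>\<omega>'. (\<integral>\<omega>. f (\<omega>, \<omega>') \<partial>M) \<partial>M)"
    by (intro Bochner_Integration.integral_cong refl integral_distr) auto
  finally show ?thesis .
qed

section \<open>Increments of the time-changed process\<close>

text \<open>Removes ties from a nondecreasing grid: in the induction a new point is appended only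
  when the last step is strict. The injection \<open>e\<close> records where each nondegenerate
  interval of \<open>t\<close> sits in the strict grid \<open>s\<close>.\<close>

lemma strictly_increasing_refinement:
  fixes t :: "nat \<Rightarrow> 'a::linorder"
  assumes "\<And>i. i < k \<Longrightarrow> t i \<le> t (Suc i)"
  obtains m s e where "\<And>i. i < m \<Longrightarrow> s i < s (Suc i)" "s 0 = t 0" "s m = t k"
    "inj_on e {i. i < k \<and> t i < t (Suc i)}"
    "\<And>i. i < k \<Longrightarrow> t i < t (Suc i) \<Longrightarrow> e i < m \<and> s (e i) = t i \<and> s (Suc (e i)) = t (Suc i)"
  using assms
proof (induction k arbitrary: thesis)
  case 0
  show ?case by (rule 0(1)[of 0 t]) auto
next
  case (Suc k)
  from Suc.IH[OF _ Suc.prems(2)] obtain m s e where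
    IH: "\<And>i. i < m \<Longrightarrow> s i < s (Suc i)" "s 0 = t 0" "s m = t k"
    "inj_on e {i. i < k \<and> t i < t (Suc i)}"
    "\<And>i. i < k \<Longrightarrow> t i < t (Suc i) \<Longrightarrow> e i < m \<and> s (e i) = t i \<and> s (Suc (e i)) = t (Suc i)"
    by (metis (no_types, lifting) less_Suc_eq)
  show ?case
  proof (cases "t k < t (Suc k)")
    case False
    then have eq: "t (Suc k) = t k" using Suc.prems(2)[of k] by simp
    then have "{i. i < Suc k \<and> t i < t (Suc i)} = {i. i < k \<and> t i < t (Suc i)}"
      by (auto simp: less_Suc_eq)
    then show ?thesis
      using IH eq by (intro Suc.prems(1)[of m s e]) (auto simp: less_Suc_eq)
  next
    case True
    then have *: "{i. i < Suc k \<and> t i < t (Suc i)} = insert k {i. i < k \<and> t i < t (Suc i)}"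
      by (auto simp: less_Suc_eq)
    have lt: "e i < m" if "i < k" "t i < t (Suc i)" for i using IH(5) that by blast
    show ?thesis
    proof (rule Suc.prems(1)[of "Suc m" "s(Suc m := t (Suc k))" "e(k := m)"])
      have "inj_on (e(k := m)) {i. i < k \<and> t i < t (Suc i)}"
        using IH(4) by (rule inj_on_cong[THEN iffD1, rotated]) auto
      then show "inj_on (e(k := m)) {i. i < Suc k \<and> t i < t (Suc i)}"
        unfolding * using lt by (auto simp: inj_on_insert dest!: lt)
    next
      fix i assume "i < Suc k" "t i < t (Suc i)"
      then show "(e(k := m)) i < Suc m \<and> (s(Suc m := t (Suc k))) ((e(k := m)) i) = t i \<and>
          (s(Suc m := t (Suc k))) (Suc ((e(k := m)) i)) = t (Suc i)"
        using IH(3) IH(5)[of i] by (cases "i = k") auto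
    qed (use IH True in \<open>auto simp: less_Suc_eq\<close>)
  qed
qed

context prob_space
begin

text \<open>
  \<open>independent_increments\<close> only speaks about strictly increasing times, whereas a
  subordinator may be constant on an interval; the increments over such intervals vanish.
\<close>

lemma independent_increments_integral_prod:
  fixes X :: "real \<Rightarrow> 'a \<Rightarrow> 'b::euclidean_space" and f :: "nat \<Rightarrow> 'b \<Rightarrow> real"
  assumes X: "independent_increments M X"
    and t: "0 \<le> t 0" "\<And>i. i < k \<Longrightarrow> t i \<le> t (Suc i)"
    and f[measurable]: "\<And>i. f i \<in> borel_measurable borel" and bound: "\<And>i x. \<bar>f i x\<bar> \<le> B"
  shows "(\<integral>\<omega>. (\<Prod>i<k. f i (X (t (Suc i)) \<omega> - X (t i) \<omega>)) \<partial>M)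
    = (\<Prod>i<k. \<integral>\<omega>. f i (X (t (Suc i)) \<omega> - X (t i) \<omega>) \<partial>M)"
proof -
  define J where "J = {i. i < k \<and> t i < t (Suc i)}"
  obtain m s e where s: "\<And>i. i < m \<Longrightarrow> s i < s (Suc i)" "s 0 = t 0"
    and "s m = t k" and inj: "inj_on e {i. i < k \<and> t i < t (Suc i)}"
    and e': "\<And>i. i < k \<Longrightarrow> t i < t (Suc i) \<Longrightarrow> e i < m \<and> s (e i) = t i \<and> s (Suc (e i)) = t (Suc i)"
    using strictly_increasing_refinement[of k t, OF t(2)] by blast
  have e: "inj_on e J" "\<And>i. i \<in> J \<Longrightarrow> e i < m \<and> s (e i) = t i \<and> s (Suc (e i)) = t (Suc i)"
    using inj e' unfolding J_def by simp_all
  have fin: "finite J" unfolding J_def by simp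
  let ?D = "\<lambda>i \<omega>. X (t (Suc i)) \<omega> - X (t i) \<omega>" and ?S = "\<lambda>l \<omega>. X (s (Suc l)) \<omega> - X (s l) \<omega>"
  \<comment> \<open>The test functions are carried over to the strict grid along \<open>e\<close>,
    so that independence of the increments over \<open>s\<close> can be applied and then read back
    over \<open>J\<close>.\<close>
  let ?g = "\<lambda>l. f (inv_into J e l)"
  have "indep_vars (\<lambda>_. borel) ?S {..<m}"
    using X s t(1) unfolding independent_increments_def by simp
  then have "indep_vars (\<lambda>_. borel) ?S (e ` J)"
    by (rule indep_vars_subset) (use e in auto)
  then have ind: "indep_vars (\<lambda>_. borel) (\<lambda>l \<omega>. ?g l (?S l \<omega>)) (e ` J)"
    by (rule indep_vars_compose2) simp
  have int: "integrable M (\<lambda>\<omega>. ?g l (?S l \<omega>))" if "l \<in> e ` J" for l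
  proof (rule integrable_const_bound[where B=B])
    show "(\<lambda>\<omega>. ?g l (?S l \<omega>)) \<in> borel_measurable M"
      using ind that unfolding indep_vars_def by blast
  qed (use bound in auto)
  have reindex: "(\<Prod>l\<in>e ` J. h l) = (\<Prod>i\<in>J. h (e i))" for h :: "nat \<Rightarrow> real"
    using e(1) by (simp add: prod.reindex)
  have "(\<integral>\<omega>. (\<Prod>l\<in>e ` J. ?g l (?S l \<omega>)) \<partial>M) = (\<Prod>l\<in>e ` J. \<integral>\<omega>. ?g l (?S l \<omega>) \<partial>M)"
    using fin by (intro indep_vars_lebesgue_integral ind int) auto
  then have J: "(\<integral>\<omega>. (\<Prod>i\<in>J. f i (?D i \<omega>)) \<partial>M) = (\<Prod>i\<in>J. \<integral>\<omega>. f i (?D i \<omega>) \<partial>M)"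
    unfolding reindex using e by (simp add: inv_into_f_f cong: prod.cong)
  have ties: "f i (?D i \<omega>) = f i 0" if "i \<in> {..<k} - J" for i \<omega>
  proof -
    have "t (Suc i) = t i" using that t(2)[of i] by (auto simp: J_def)
    then show ?thesis by simp
  qed
  have split: "(\<Prod>i<k. h i) = (\<Prod>i\<in>{..<k} - J. h i) * (\<Prod>i\<in>J. h i)" for h :: "nat \<Rightarrow> real"
    by (rule prod.subset_diff) (auto simp: J_def)
  have "(\<integral>\<omega>. (\<Prod>i<k. f i (?D i \<omega>)) \<partial>M) = (\<integral>\<omega>. (\<Prod>i\<in>{..<k} - J. f i 0) * (\<Prod>i\<in>J. f i (?D i \<omega>)) \<partial>M)"
    by (intro Bochner_Integration.integral_cong refl, subst split) (intro arg_cong2[where f="(*)"] prod.cong refl ties)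
  also have "\<dots> = (\<Prod>i\<in>{..<k} - J. f i 0) * (\<Prod>i\<in>J. \<integral>\<omega>. f i (?D i \<omega>) \<partial>M)"
    by (simp only: integral_mult_right_zero J)
  also have "(\<Prod>i\<in>{..<k} - J. f i 0) = (\<Prod>i\<in>{..<k} - J. \<integral>\<omega>. f i (?D i \<omega>) \<partial>M)"
    by (intro prod.cong refl) (simp add: ties prob_space)
  finally show ?thesis by (simp only: split)
qed

end

section \<open>The time change: measurability, paths and independence of increments\<close>

locale time_changed_levy = prob_space M
  for M :: "'w measure" and X :: "real \<Rightarrow> 'w \<Rightarrow> 'b::euclidean_space" and Z :: "real \<Rightarrow> 'w \<Rightarrow> real" +
  assumes levy: "levy_process M X"
    and subordinator: "additive_subordinator M Z"
    and indep: "independent_processes M X Z"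
begin

lemma X_measurable: "0 \<le> t \<Longrightarrow> X t \<in> borel_measurable M"
  and X_cadlag: "\<omega> \<in> space M \<Longrightarrow> cadlag (\<lambda>t. X t \<omega>)"
  and X_indep: "independent_increments M X"
  and X_stationary: "stationary_increments M X"
  using levy unfolding levy_process_def additive_process_def by auto

lemma Z_measurable: "0 \<le> t \<Longrightarrow> Z t \<in> borel_measurable M"
  and Z_cadlag: "\<omega> \<in> space M \<Longrightarrow> cadlag (\<lambda>t. Z t \<omega>)"
  and Z_indep: "independent_increments M Z"
  and Z_nonneg: "\<omega> \<in> space M \<Longrightarrow> 0 \<le> t \<Longrightarrow> 0 \<le> Z t \<omega>"
  and Z_mono: "\<omega> \<in> space M \<Longrightarrow> mono_on {0..} (\<lambda>t. Z t \<omega>)"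
  using subordinator unfolding additive_subordinator_def additive_process_def by auto

text \<open>\<open>X\<close> extended to all real times by clipping at 0, so that it is jointly
  measurable on the whole line without side conditions on the time argument.\<close>

definition flow :: "real \<Rightarrow> 'w \<Rightarrow> 'b" where "flow r \<omega> = X (max 0 r) \<omega>"

lemma flow_eq: "0 \<le> r \<Longrightarrow> flow r = X r"
  by (auto simp: flow_def)

lemma flow_measurable_process:
  "case_prod flow \<in> borel_measurable (borel \<Otimes>\<^sub>M process_space M X)"
  unfolding flow_def[abs_def] using cadlag_jointly_measurable[of M X] X_cadlag by blast

lemma flow_measurable [measurable (raw)]:
  assumes [measurable]: "T \<in> borel_measurable N" "h \<in> measurable N M"
  shows "(\<lambda>p. flow (T p) (h p)) \<in> borel_measurable N"
proof -
  have [measurable]: "(\<lambda>\<omega>. \<omega>) \<in> measurable M (process_space M X)"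
    using X_measurable by (rule ident_measurable_process_space)
  have "(\<lambda>p. (T p, h p)) \<in> measurable N (borel \<Otimes>\<^sub>M process_space M X)"
    using measurable_compose[OF assms(2), of "\<lambda>\<omega>. \<omega>"] by simp
  from measurable_compose[OF this flow_measurable_process] show ?thesis by simp
qed

lemma time_change_eq_flow: "0 \<le> t \<Longrightarrow> \<omega> \<in> space M \<Longrightarrow> time_change X Z t \<omega> = flow (Z t \<omega>) \<omega>"
  using Z_nonneg by (simp add: time_change_def flow_eq)

lemma time_change_measurable: "0 \<le> t \<Longrightarrow> time_change X Z t \<in> borel_measurable M"
  using Z_measurable[of t] by (subst measurable_cong[OF time_change_eq_flow]) auto

lemma time_change_cadlag: "\<omega> \<in> space M \<Longrightarrow> cadlag (\<lambda>t. time_change X Z t \<omega>)"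
  unfolding time_change_def
  using cadlag_compose_mono[of "\<lambda>t. X t \<omega>" "\<lambda>t. Z t \<omega>"] X_cadlag Z_cadlag Z_mono Z_nonneg by simp

text \<open>Stationarity turns the law of an increment into a function of the time difference alone.
  The term \<open>flow 0\<close> stays because \<open>X 0\<close> vanishes only almost
  surely.\<close>

lemma integral_flow_increment:
  fixes f :: "'b \<Rightarrow> real"
  assumes [measurable]: "f \<in> borel_measurable borel" and st: "0 \<le> s" "s \<le> t"
  shows "(\<integral>\<omega>. f (X t \<omega> - X s \<omega>) \<partial>M) = (\<integral>\<omega>. f (flow (t - s) \<omega> - flow 0 \<omega>) \<partial>M)"
proof -
  have [measurable]: "X t \<in> borel_measurable M" "X s \<in> borel_measurable M"
    using X_measurable st by auto
  have "distr M borel (\<lambda>\<omega>. X (s + (t - s)) \<omega> - X s \<omega>) = distr M borel (\<lambda>\<omega>. X (t - s) \<omega> - X 0 \<omega>)"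
    using X_stationary st unfolding stationary_increments_def by (metis diff_ge_0_iff_ge)
  then have "distr M borel (\<lambda>\<omega>. X t \<omega> - X s \<omega>) = distr M borel (\<lambda>\<omega>. flow (t - s) \<omega> - flow 0 \<omega>)"
    using st by (simp add: flow_eq)
  then have "integral\<^sup>L (distr M borel (\<lambda>\<omega>. X t \<omega> - X s \<omega>)) f
      = integral\<^sup>L (distr M borel (\<lambda>\<omega>. flow (t - s) \<omega> - flow 0 \<omega>)) f" by simp
  then show ?thesis by (simp add: integral_distr)
qed

text \<open>For a frozen outcome \<open>\<omega>'\<close> of \<open>Z\<close>, the times
  \<open>Z (t i) \<omega>'\<close> are nondecreasing, so the product splits by independence of the
  increments of \<open>X\<close>, and by stationarity each factor depends on one increment of
  \<open>Z\<close> only.\<close>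

lemma integral_time_change_prod:
  fixes f :: "nat \<Rightarrow> 'b \<Rightarrow> real"
  assumes t: "0 \<le> t 0" "\<And>i. i < k \<Longrightarrow> t i \<le> t (Suc i)"
    and f[measurable]: "\<And>i. f i \<in> borel_measurable borel" and bound: "\<And>i x. \<bar>f i x\<bar> \<le> 1"
  shows "(\<integral>\<omega>. (\<Prod>i<k. f i (time_change X Z (t (Suc i)) \<omega> - time_change X Z (t i) \<omega>)) \<partial>M)
    = (\<integral>\<omega>'. (\<Prod>i<k. \<integral>\<omega>. f i (flow (Z (t (Suc i)) \<omega>' - Z (t i) \<omega>') \<omega> - flow 0 \<omega>) \<partial>M) \<partial>M)"
proof -
  have tpos: "0 \<le> t i" if "i \<le> k" for i
    using that
  proof (induction i)
    case (Suc i) then show ?case using t(2)[of i] by simp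
  qed (use t in simp)
  \<comment> \<open>The first coordinate drives \<open>X\<close> and the second drives
    \<open>Z\<close>; on the diagonal this is the product of the time-changed increments.\<close>
  define h where "h = (\<lambda>p. \<Prod>i<k. f i (flow (Z (t (Suc i)) (snd p)) (fst p) - flow (Z (t i) (snd p)) (fst p)))"
  have [measurable]: "(\<lambda>p. flow (Z (t i) (snd p)) (fst p))
      \<in> borel_measurable (process_space M X \<Otimes>\<^sub>M process_space M Z)" if "i \<le> k" for i
  proof -
    have [measurable]: "Z (t i) \<in> borel_measurable (process_space M Z)"
      using tpos that by (intro measurable_process_space) auto
    have "(\<lambda>p. (Z (t i) (snd p), fst p)) \<in> measurable (process_space M X \<Otimes>\<^sub>M process_space M Z) (borel \<Otimes>\<^sub>M process_space M X)"
      by measurable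
    from measurable_compose[OF this flow_measurable_process] show ?thesis by simp
  qed
  have h[measurable]: "h \<in> borel_measurable (process_space M X \<Otimes>\<^sub>M process_space M Z)"
    unfolding h_def by measurable
  have hb: "norm (h p) \<le> 1" for p
    unfolding h_def real_norm_def abs_prod by (intro prod_le_1) (use bound in auto)
  have "(\<integral>\<omega>. (\<Prod>i<k. f i (time_change X Z (t (Suc i)) \<omega> - time_change X Z (t i) \<omega>)) \<partial>M) = (\<integral>\<omega>. h (\<omega>, \<omega>) \<partial>M)"
    by (intro Bochner_Integration.integral_cong refl) (auto simp: h_def time_change_eq_flow tpos intro!: prod.cong)
  also have "\<dots> = (\<integral>\<omega>'. (\<integral>\<omega>. h (\<omega>, \<omega>') \<partial>M) \<partial>M)"
    by (rule independent_processes_Fubini[OF indep X_measurable Z_measurable h hb])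
  also have "\<dots> = (\<integral>\<omega>'. (\<Prod>i<k. \<integral>\<omega>. f i (flow (Z (t (Suc i)) \<omega>' - Z (t i) \<omega>') \<omega> - flow 0 \<omega>) \<partial>M) \<partial>M)"
  proof (intro Bochner_Integration.integral_cong refl)
    fix \<omega>' assume w: "\<omega>' \<in> space M"
    have le: "Z (t i) \<omega>' \<le> Z (t (Suc i)) \<omega>'" if "i < k" for i
      using that tpos t(2) by (intro mono_onD[OF Z_mono[OF w]]) auto
    have pos: "0 \<le> Z (t i) \<omega>'" if "i \<le> k" for i using Z_nonneg[OF w] tpos that by auto
    have "(\<integral>\<omega>. h (\<omega>, \<omega>') \<partial>M) = (\<integral>\<omega>. (\<Prod>i<k. f i (X (Z (t (Suc i)) \<omega>') \<omega> - X (Z (t i) \<omega>') \<omega>)) \<partial>M)"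
      unfolding h_def using pos by (simp add: flow_eq)
    also have "\<dots> = (\<Prod>i<k. \<integral>\<omega>. f i (X (Z (t (Suc i)) \<omega>') \<omega> - X (Z (t i) \<omega>') \<omega>) \<partial>M)"
      by (rule independent_increments_integral_prod[where t="\<lambda>i. Z (t i) \<omega>'", OF X_indep _ _ f bound])
         (use le pos[of 0] in auto)
    also have "\<dots> = (\<Prod>i<k. \<integral>\<omega>. f i (flow (Z (t (Suc i)) \<omega>' - Z (t i) \<omega>') \<omega> - flow 0 \<omega>) \<partial>M)"
      using le pos by (intro prod.cong refl integral_flow_increment) auto
    finally show "(\<integral>\<omega>. h (\<omega>, \<omega>') \<partial>M) = \<dots>" .
  qed
  finally show ?thesis .
qed

text \<open>With indicators as test functions, integrating out \<open>X\<close> leaves a product of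
  functions \<open>F i\<close> of the increments of \<open>Z\<close>. Independence of those
  increments splits the expectation, and the one-factor case identifies each factor with a
  probability for the time-changed process.\<close>

lemma time_change_independent_increments: "independent_increments M (time_change X Z)"
  unfolding independent_increments_def
proof (intro allI impI)
  fix k and t :: "nat \<Rightarrow> real" assume t0: "0 \<le> t 0" and t: "\<forall>i<k. t i < t (Suc i)"
  let ?Y = "\<lambda>i \<omega>. time_change X Z (t (Suc i)) \<omega> - time_change X Z (t i) \<omega>"
  have tpos: "0 \<le> t i" if "i \<le> k" for i
    using that
  proof (induction i)
    case (Suc i) then show ?case using t by (auto intro: order.trans[OF _ less_imp_le])
  qed (use t0 in simp)
  have Y[measurable]: "?Y i \<in> borel_measurable M" if "i < k" for i
    using tpos that by (intro borel_measurable_diff time_change_measurable) auto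
  show "indep_vars (\<lambda>_. borel) ?Y {..<k}"
  proof (cases "k = 0")
    \<comment> \<open>The product criterion \<open>indep_vars_finite\<close> requires a nonempty
      index set, so the empty family is treated apart.\<close>
    case True
    then show ?thesis by (simp add: indep_vars_def indep_sets_def)
  next
    case False
    show ?thesis
    proof (subst indep_vars_finite[where E="\<lambda>_. sets borel"], goal_cases)
      \<comment> \<open>The eighth goal is the product formula over Borel sets; the side conditions
        of the criterion are discharged by the closing \<open>use\<close>.\<close>
      case 8
      show ?case
      proof (intro ballI)
        fix A :: "nat \<Rightarrow> 'b set" assume A: "A \<in> {..<k} \<rightarrow> sets borel"
        \<comment> \<open>\<open>A i\<close> is known to be Borel only for \<open>i < k\<close>; the
          empty set elsewhere keeps every \<open>f i\<close> measurable.\<close>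
        define f :: "nat \<Rightarrow> 'b \<Rightarrow> real" where "f i = indicator (if i < k then A i else {})" for i
        define F where "F i h = (\<integral>\<omega>. f i (flow h \<omega> - flow 0 \<omega>) \<partial>M)" for i h
        have f[measurable]: "f i \<in> borel_measurable borel" for i
          using A unfolding f_def by (cases "i < k") (auto intro!: borel_measurable_indicator)
        have bound: "\<bar>f i x\<bar> \<le> 1" for i x by (auto simp: f_def indicator_def)
        have F[measurable]: "F i \<in> borel_measurable borel" for i unfolding F_def by measurable
        have F_le: "norm (F i h) \<le> 1" for i h
        proof -
          have "norm (F i h) \<le> (\<integral>\<omega>. norm (f i (flow h \<omega> - flow 0 \<omega>)) \<partial>M)"
            unfolding F_def by (rule integral_norm_bound)
          also have "\<dots> \<le> (\<integral>\<omega>. 1 \<partial>M)"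
          proof (rule integral_mono)
            show "integrable M (\<lambda>\<omega>. norm (f i (flow h \<omega> - flow 0 \<omega>)))"
              by (rule integrable_const_bound[where B=1]) (simp_all add: bound)
          qed (simp_all add: bound)
          finally show ?thesis by (simp add: prob_space)
        qed
        have indep_F: "indep_vars (\<lambda>_. borel) (\<lambda>i \<omega>. F i (Z (t (Suc i)) \<omega> - Z (t i) \<omega>)) {..<k}"
          using Z_indep t0 t unfolding independent_increments_def
          by (intro indep_vars_compose2[where M'="\<lambda>_. borel" and Y=F]) auto
        have int_F: "integrable M (\<lambda>\<omega>. F i (Z (t (Suc i)) \<omega> - Z (t i) \<omega>))" if "i < k" for i
        proof -
          have [measurable]: "Z (t (Suc i)) \<in> borel_measurable M" "Z (t i) \<in> borel_measurable M"
            using that tpos by (auto intro!: Z_measurable)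
          show ?thesis by (rule integrable_const_bound[where B=1]) (use F_le in auto)
        qed
        \<comment> \<open>The one-interval instance of the product formula, with the grid shifted to
          start at \<open>t i\<close>.\<close>
        have single: "(\<integral>\<omega>. f i (?Y i \<omega>) \<partial>M) = (\<integral>\<omega>. F i (Z (t (Suc i)) \<omega> - Z (t i) \<omega>) \<partial>M)" if "i < k" for i
          using integral_time_change_prod[where t="\<lambda>j. t (i + j)" and k=1 and f="\<lambda>_. f i", OF _ _ f bound]
            tpos[of i] t that by (simp add: F_def less_imp_le)
        have prob_eq: "prob (?Y i -` A i \<inter> space M) = (\<integral>\<omega>. f i (?Y i \<omega>) \<partial>M)" if "i < k" for i
          unfolding f_def using that
          by (subst Bochner_Integration.integral_cong[OF refl, of _ _ "indicator (?Y i -` A i \<inter> space M)"])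
             (auto simp: indicator_def)
        have "prob (\<Inter>i<k. ?Y i -` A i \<inter> space M) = (\<integral>\<omega>. (\<Prod>i<k. f i (?Y i \<omega>)) \<partial>M)"
        proof -
          have "(\<Prod>i<k. f i (?Y i \<omega>)) = indicator (\<Inter>i<k. ?Y i -` A i \<inter> space M) \<omega>" if "\<omega> \<in> space M" for \<omega>
          proof (cases "\<forall>i<k. ?Y i \<omega> \<in> A i")
            case True
            then show ?thesis using that False by (auto simp: f_def indicator_def)
          next
            case False
            then show ?thesis by (auto simp: f_def indicator_def prod_zero_iff)
          qed
          then show ?thesis
            using False by (subst Bochner_Integration.integral_cong[OF refl, of _ _ "indicator (\<Inter>i<k. ?Y i -` A i \<inter> space M)"])
             (auto simp: Int_absorb1 Int_absorb2)
        qed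
        also have "\<dots> = (\<integral>\<omega>. (\<Prod>i<k. F i (Z (t (Suc i)) \<omega> - Z (t i) \<omega>)) \<partial>M)"
          unfolding F_def by (rule integral_time_change_prod[where t=t and f=f, OF t0 _ f bound]) (use t in \<open>auto intro: less_imp_le\<close>)
        also have "\<dots> = (\<Prod>i<k. \<integral>\<omega>. F i (Z (t (Suc i)) \<omega> - Z (t i) \<omega>) \<partial>M)"
          using int_F by (intro indep_vars_lebesgue_integral indep_F) auto
        also have "\<dots> = (\<Prod>i<k. prob (?Y i -` A i \<inter> space M))"
          by (intro prod.cong refl) (simp add: single prob_eq)
        finally show "prob (\<Inter>i<k. ?Y i -` A i \<inter> space M) = (\<Prod>i<k. prob (?Y i -` A i \<inter> space M))" .
      qed
    qed (use False Y sets.sigma_sets_eq[of borel] in \<open>auto simp: sets.Int_stable\<close>)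
  qed
qed

lemma time_change_additive: "additive_process M (time_change X Z)"
  unfolding additive_process_def
  using time_change_measurable time_change_cadlag time_change_independent_increments by blast

text \<open>Single-time counterpart of the product formula for vector-valued test functions, as
  needed for complex exponentials.\<close>

lemma integral_time_change:
  fixes f :: "'b \<Rightarrow> 'd::{banach, second_countable_topology}"
  assumes t: "0 \<le> t" and [measurable]: "f \<in> borel_measurable borel" and bound: "\<And>x. norm (f x) \<le> B"
  shows "(\<integral>\<omega>. f (time_change X Z t \<omega>) \<partial>M) = (\<integral>\<omega>'. (\<integral>\<omega>. f (X (Z t \<omega>') \<omega>) \<partial>M) \<partial>M)"
proof -
  have [measurable]: "Z t \<in> borel_measurable (process_space M Z)"
    using t by (intro measurable_process_space) auto
  have "(\<lambda>p. (Z t (snd p), fst p)) \<in> measurable (process_space M X \<Otimes>\<^sub>M process_space M Z) (borel \<Otimes>\<^sub>M process_space M X)"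
    by measurable
  from measurable_compose[OF this flow_measurable_process]
  have [measurable]: "(\<lambda>p. flow (Z t (snd p)) (fst p)) \<in> borel_measurable (process_space M X \<Otimes>\<^sub>M process_space M Z)" by simp
  have "(\<integral>\<omega>. f (time_change X Z t \<omega>) \<partial>M) = (\<integral>\<omega>. (\<lambda>p. f (flow (Z t (snd p)) (fst p))) (\<omega>, \<omega>) \<partial>M)"
    using t by (intro Bochner_Integration.integral_cong refl) (simp add: time_change_eq_flow)
  also have "\<dots> = (\<integral>\<omega>'. (\<integral>\<omega>. (\<lambda>p. f (flow (Z t (snd p)) (fst p))) (\<omega>, \<omega>') \<partial>M) \<partial>M)"
    by (rule independent_processes_Fubini[OF indep X_measurable Z_measurable _ bound]) simp_all
  also have "\<dots> = (\<integral>\<omega>'. (\<integral>\<omega>. f (X (Z t \<omega>') \<omega>) \<partial>M) \<partial>M)"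
    using t by (intro Bochner_Integration.integral_cong refl) (simp add: flow_eq Z_nonneg)
  finally show ?thesis .
qed

end

section \<open>Bounds from the characteristic function\<close>

definition levy_integrand :: "real^'n \<Rightarrow> real^'n \<Rightarrow> complex" where
  "levy_integrand u x =
     iexp (u \<bullet> x) - 1 - \<i> * complex_of_real (u \<bullet> x) * indicator {x. norm x \<le> 1} x"

lemma levy_integrand_0 [simp]: "levy_integrand u 0 = 0"
  by (simp add: levy_integrand_def)

lemma levy_integrand_measurable [measurable]: "levy_integrand u \<in> borel_measurable borel"
  unfolding levy_integrand_def[abs_def] by measurable

text \<open>In the unit ball the integrand is the remainder of the first-order expansion of the
  exponential, hence quadratic; outside it there is no compensator and the modulus is at most
  2.\<close>

lemma cmod_levy_integrand_le:
  "cmod (levy_integrand u x) \<le> (2 + (norm u)\<^sup>2) * min ((norm x)\<^sup>2) 1"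
proof (cases "norm x \<le> 1")
  case True
  have "cmod (levy_integrand u x) = cmod (iexp (u \<bullet> x) - (\<Sum>k\<le>1. (\<i> * complex_of_real (u \<bullet> x)) ^ k / fact k))"
    using True by (simp add: levy_integrand_def algebra_simps)
  also have "\<dots> \<le> \<bar>u \<bullet> x\<bar> ^ 2 / 2"
    using iexp_approx1[of "u \<bullet> x" 1] by (simp add: numeral_2_eq_2)
  also have "\<dots> \<le> (norm u * norm x) ^ 2 / 2"
    by (intro divide_right_mono power_mono Cauchy_Schwarz_ineq2) auto
  also have "\<dots> \<le> (2 + (norm u)\<^sup>2) * (norm x)\<^sup>2"
    by (simp add: power_mult_distrib distrib_right)
  also have "(norm x)\<^sup>2 = min ((norm x)\<^sup>2) 1"
    using True by (simp add: power_le_one)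
  finally show ?thesis .
next
  case False
  then have "1 \<le> (norm x)\<^sup>2" by (simp add: one_le_power)
  moreover have "cmod (levy_integrand u x) \<le> cmod (iexp (u \<bullet> x)) + cmod 1"
    using False norm_triangle_ineq4[of "iexp (u \<bullet> x)" 1] by (simp add: levy_integrand_def)
  ultimately show ?thesis by (auto simp: min_absorb2 intro: add_increasing2)
qed

lemma levy_measure_borel_measurable:
  fixes f :: "real^'n \<Rightarrow> 'b::topological_space"
  assumes "levy_measure \<nu>" and f: "f \<in> borel_measurable borel"
  shows "f \<in> borel_measurable \<nu>"
proof -
  have "f \<in> borel_measurable punctured_borel"
    using f by (rule measurable_restrict_space1)
  then show ?thesis
    using assms measurable_cong_sets[of \<nu> punctured_borel borel "borel :: 'b measure"]
    by (simp add: levy_measure_def)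
qed

lemma levy_measure_integrable:
  assumes "levy_measure \<nu>"
  shows "integrable \<nu> (\<lambda>x. min ((norm x)\<^sup>2) 1)"
proof (rule integrableI_bounded)
  show "(\<integral>\<^sup>+x. ennreal (norm (min ((norm x)\<^sup>2) 1)) \<partial>\<nu>) < \<infinity>"
    using assms by (simp add: levy_measure_def)
qed (intro levy_measure_borel_measurable[OF assms], measurable)

lemma levy_integrand_integrable:
  assumes "levy_measure \<nu>"
  shows "integrable \<nu> (levy_integrand u)"
proof (rule Bochner_Integration.integrable_bound)
  show "integrable \<nu> (\<lambda>x. (2 + (norm u)\<^sup>2) * min ((norm x)\<^sup>2) 1)"
    using levy_measure_integrable[OF assms] by simp
  show "levy_integrand u \<in> borel_measurable \<nu>"
    by (rule levy_measure_borel_measurable[OF assms levy_integrand_measurable])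
qed (use cmod_levy_integrand_le[of u] in auto)

lemma levy_exponent_altdef:
  "levy_exponent c Q \<nu> u =
     \<i> * complex_of_real (u \<bullet> c) - 1/2 * complex_of_real (u \<bullet> (Q *v u)) + (LINT x|\<nu>. levy_integrand u x)"
  unfolding levy_exponent_def levy_integrand_def ..

text \<open>Drift, Gaussian and jump parts are bounded separately. The uniform growth rate in
  \<open>u\<close> is what later converts control of the characteristic function into moment
  bounds.\<close>

lemma levy_exponent_quadratic_bound:
  fixes c :: "real^'n"
  assumes "levy_measure \<nu>"
  obtains K where "0 \<le> K" "\<And>u. cmod (levy_exponent c Q \<nu> u) \<le> K * (1 + (norm u)\<^sup>2)"
proof -
  obtain B where B: "0 \<le> B" "\<And>u. norm (Q *v u) \<le> norm u * B"
    using bounded_linear.nonneg_bounded[OF matrix_vector_mul_bounded_linear[of Q]] by blast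
  define I where "I = (LINT x|\<nu>. min ((norm x)\<^sup>2) 1)"
  have I: "0 \<le> I" unfolding I_def by (intro integral_nonneg_AE) auto
  show ?thesis
  proof (rule that)
    fix u :: "real^'n"
    have c: "cmod (\<i> * complex_of_real (u \<bullet> c)) \<le> norm c * (1 + (norm u)\<^sup>2)"
    proof -
      have "cmod (\<i> * complex_of_real (u \<bullet> c)) \<le> norm c * norm u"
        using Cauchy_Schwarz_ineq2[of u c] by (simp add: norm_mult mult.commute)
      also have "norm u \<le> 1 + (norm u)\<^sup>2"
        \<comment> \<open>Expanding the square of \<open>norm u - 1/2\<close> gives
          \<open>norm u \<le> (norm u)\<^sup>2 + 1/4\<close>.\<close>
        using sum_squares_ge_zero[of "norm u - 1/2" 0] by (simp add: power2_eq_square algebra_simps)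
      finally show ?thesis by (simp add: mult_left_mono)
    qed
    have Q: "cmod (1/2 * complex_of_real (u \<bullet> (Q *v u))) \<le> B * (1 + (norm u)\<^sup>2)"
    proof -
      have "cmod (1/2 * complex_of_real (u \<bullet> (Q *v u))) \<le> \<bar>u \<bullet> (Q *v u)\<bar>"
        by (simp add: norm_mult)
      also have "\<dots> \<le> norm u * norm (Q *v u)" by (rule Cauchy_Schwarz_ineq2)
      also have "\<dots> \<le> norm u * (norm u * B)" by (intro mult_left_mono B) auto
      also have "\<dots> \<le> B * (1 + (norm u)\<^sup>2)" using B by (simp add: power2_eq_square algebra_simps)
      finally show ?thesis .
    qed
    have \<nu>: "cmod (LINT x|\<nu>. levy_integrand u x) \<le> (2 * I) * (1 + (norm u)\<^sup>2)"
    proof -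
      have "cmod (LINT x|\<nu>. levy_integrand u x) \<le> (LINT x|\<nu>. cmod (levy_integrand u x))"
        by (rule integral_norm_bound)
      also have "\<dots> \<le> (LINT x|\<nu>. (2 + (norm u)\<^sup>2) * min ((norm x)\<^sup>2) 1)"
        by (intro integral_mono cmod_levy_integrand_le integrable_norm levy_integrand_integrable
              integrable_mult_right levy_measure_integrable assms)
      also have "\<dots> = (2 + (norm u)\<^sup>2) * I" by (simp add: I_def)
      also have "\<dots> \<le> (2 * (1 + (norm u)\<^sup>2)) * I" by (intro mult_right_mono I) auto
      finally show ?thesis by (simp add: mult_ac)
    qed
    show "cmod (levy_exponent c Q \<nu> u) \<le> (norm c + B + 2 * I) * (1 + (norm u)\<^sup>2)"
      unfolding levy_exponent_altdef distrib_right
      by (intro order.trans[OF norm_triangle_ineq] add_mono order.trans[OF norm_triangle_ineq4] c Q \<nu>)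
  qed (use B I in simp)
qed

text \<open>Mean value inequality on the convex left half-plane, where the derivative of
  \<open>exp\<close> has modulus at most 1.\<close>

lemma cmod_exp_minus_one_le:
  assumes "Re z \<le> 0"
  shows "cmod (exp z - 1) \<le> cmod z"
proof -
  have "cmod (exp z - exp 0) \<le> 1 * cmod (z - 0)"
  proof (rule field_differentiable_bound[of "{z. Re z \<le> 0}" exp exp])
    show "convex {z. Re z \<le> 0}" by (rule convex_halfspace_Re_le)
  qed (use assms in \<open>auto intro: DERIV_subset DERIV_exp\<close>)
  then show ?thesis by simp
qed

section \<open>Moment bounds obtained from the characteristic function near 1\<close>

lemma min_square_le_sum:
  fixes x :: "real^'n"
  shows "min ((norm x)\<^sup>2) 1 \<le> (\<Sum>i\<in>UNIV. min ((x $ i)\<^sup>2) 1)"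
proof (cases "\<exists>i. 1 \<le> (x $ i)\<^sup>2")
  case True
  then obtain i where "1 \<le> (x $ i)\<^sup>2" ..
  then have "min ((norm x)\<^sup>2) 1 \<le> min ((x $ i)\<^sup>2) 1" by simp
  also have "\<dots> \<le> (\<Sum>i\<in>UNIV. min ((x $ i)\<^sup>2) 1)" by (rule member_le_sum) auto
  finally show ?thesis .
next
  case False
  then have "(\<Sum>i\<in>UNIV. min ((x $ i)\<^sup>2) 1) = (\<Sum>i\<in>UNIV. (x $ i)\<^sup>2)"
    by (intro sum.cong) (auto simp: not_le)
  also have "\<dots> = (norm x)\<^sup>2"
    by (simp add: norm_vec_def L2_set_def sum_nonneg)
  finally show ?thesis by simp
qed

text \<open>With \<open>y = x\<^sup>2 / 2\<close>, the inequality \<open>1 + y \<le> exp y\<close>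
  gives \<open>1 - exp (- y) \<ge> y / (1 + y)\<close>; comparing the latter with
  \<open>min (2 * y) 1\<close> on either side of \<open>y = 1/2\<close> yields the factor 4.\<close>

lemma min_square_le_gaussian: "min (x\<^sup>2) 1 \<le> 4 * (1 - exp (- (x\<^sup>2) / 2))" for x :: real
proof -
  define y where "y = x\<^sup>2 / 2"
  have y: "0 \<le> y" by (simp add: y_def)
  have "exp (- y) \<le> inverse (1 + y)"
    using exp_ge_add_one_self[of y] y by (simp add: exp_minus le_imp_inverse_le)
  then have "1 - inverse (1 + y) \<le> 1 - exp (- y)" by simp
  moreover have "1 - inverse (1 + y) = y / (1 + y)" using y by (simp add: field_simps)
  moreover have "min (2 * y) 1 \<le> 4 * (y / (1 + y))"
    using y mult_mono[of y "1/2" y y] by (auto simp: min_def field_simps)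
  ultimately show ?thesis by (simp add: y_def)
qed

text \<open>
  Averaging \<open>1 - cos (v * x)\<close> over a standard Gaussian \<open>v\<close> yields
  \<open>1 - exp (- x\<^sup>2 / 2)\<close>, which dominates \<open>min (x\<^sup>2) 1\<close>; this turns the quadratic bound on the
  characteristic function into a moment bound.
\<close>

context prob_space
begin

lemma expectation_min_square_le:
  fixes W :: "'a \<Rightarrow> real"
  assumes [measurable]: "W \<in> borel_measurable M"
    and K: "\<And>v. cmod ((LINT \<omega>|M. iexp (v * W \<omega>)) - 1) \<le> K * (1 + v\<^sup>2)"
  shows "(LINT \<omega>|M. min ((W \<omega>)\<^sup>2) 1) \<le> 8 * K"
proof -
  let ?N = std_normal_distribution
  interpret N: real_distribution ?N by (rule real_dist_normal_dist)
  interpret P: pair_prob_space M ?N ..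
  have int_iexp: "integrable M (\<lambda>\<omega>. iexp (v * W \<omega>))" for v
    by (rule integrable_const_bound[where B=1]) auto
  have int_cos: "integrable M (\<lambda>\<omega>. cos (v * W \<omega>))" for v
    by (rule integrable_const_bound[where B=1]) auto
  have int_N: "integrable ?N (\<lambda>v. cos (v * x))" for x
    by (rule N.integrable_const_bound[where B=1]) auto
  have cos_bound: "\<bar>1 - cos y\<bar> \<le> 2" for y :: real
    using cos_le_one[of y] cos_ge_minus_one[of y] by linarith
  have int_P: "integrable (M \<Otimes>\<^sub>M ?N) (\<lambda>(\<omega>, v). 1 - cos (v * W \<omega>))"
    by (rule P.integrable_const_bound[where B=2]) (use cos_bound in auto)
  have cosN: "(LINT v|?N. 1 - cos (v * x)) = 1 - exp (- (x\<^sup>2) / 2)" for x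
  proof -
    have "(LINT v|?N. cos (v * x)) = Re (char ?N x)"
      unfolding char_def
      by (subst integral_Re[symmetric]) (auto intro!: N.integrable_const_bound[where B=1] simp: Re_exp mult.commute)
    then show ?thesis
      using int_N[of x] N.prob_space by (simp add: char_std_normal_distribution)
  qed
  have cosM: "(LINT \<omega>|M. 1 - cos (v * W \<omega>)) \<le> K * (1 + v\<^sup>2)" for v
  proof -
    have "(LINT \<omega>|M. cos (v * W \<omega>)) = Re (LINT \<omega>|M. iexp (v * W \<omega>))"
      by (subst integral_Re[symmetric]) (use int_iexp in \<open>auto simp: Re_exp\<close>)
    then have "(LINT \<omega>|M. 1 - cos (v * W \<omega>)) = Re (1 - (LINT \<omega>|M. iexp (v * W \<omega>)))"
      using int_cos[of v] by (simp add: prob_space)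
    also have "\<dots> \<le> cmod ((LINT \<omega>|M. iexp (v * W \<omega>)) - 1)"
      using complex_Re_le_cmod[of "1 - (LINT \<omega>|M. iexp (v * W \<omega>))"] by (simp add: norm_minus_commute)
    finally show ?thesis using K[of v] by simp
  qed
  \<comment> \<open>The second moment of the standard normal is 1, whence \<open>2 * K\<close>;
    together with the factor 4 of \<open>min_square_le_gaussian\<close> this produces the constant
    8.\<close>
  have mom: "integrable ?N (\<lambda>v. K * (1 + v\<^sup>2))" "(LINT v|?N. K * (1 + v\<^sup>2)) = 2 * K"
    using integrable_std_normal_distribution_moment[of 2] std_normal_distribution_even_moments[of 1]
      N.prob_space by (auto simp: numeral_2_eq_2 simp del: One_nat_def)
  have "(LINT \<omega>|M. min ((W \<omega>)\<^sup>2) 1) \<le> (LINT \<omega>|M. 4 * (1 - exp (- ((W \<omega>)\<^sup>2) / 2)))"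
  proof (intro integral_mono min_square_le_gaussian)
    show "integrable M (\<lambda>\<omega>. min ((W \<omega>)\<^sup>2) 1)"
      by (rule integrable_const_bound[where B=1]) auto
    show "integrable M (\<lambda>\<omega>. 4 * (1 - exp (- ((W \<omega>)\<^sup>2) / 2)))"
      by (rule integrable_const_bound[where B=4]) auto
  qed
  also have "\<dots> = 4 * (LINT \<omega>|M. LINT v|?N. 1 - cos (v * W \<omega>))"
    by (simp only: cosN integral_mult_right_zero)
  also have "(LINT \<omega>|M. LINT v|?N. 1 - cos (v * W \<omega>)) = (LINT v|?N. LINT \<omega>|M. 1 - cos (v * W \<omega>))"
    using P.Fubini_integral[OF int_P] by simp
  also have "\<dots> \<le> (LINT v|?N. K * (1 + v\<^sup>2))"
    using P.integrable_snd[OF int_P] by (intro integral_mono mom cosM)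
  finally show ?thesis unfolding mom(2) by simp
qed

text \<open>Restricting the hypothesis to multiples of a coordinate vector gives the scalar bound
  for each coordinate; summing costs the dimension.\<close>

lemma expectation_min_norm_square_le:
  fixes V :: "'a \<Rightarrow> real^'n" and K :: real
  assumes [measurable]: "V \<in> borel_measurable M"
    and K: "\<And>u. cmod ((LINT \<omega>|M. iexp (u \<bullet> V \<omega>)) - 1) \<le> K * (1 + (norm u)\<^sup>2)"
  shows "(LINT \<omega>|M. min ((norm (V \<omega>))\<^sup>2) 1) \<le> 8 * real CARD('n) * K"
proof -
  have [measurable]: "(\<lambda>\<omega>. V \<omega> $ i) \<in> borel_measurable M" for i
    by (rule measurable_compose[OF assms(1) borel_measurable_continuous_onI]) (intro continuous_intros)
  have i: "(LINT \<omega>|M. min ((V \<omega> $ i)\<^sup>2) 1) \<le> 8 * K" for i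
  proof (rule expectation_min_square_le)
    show "cmod ((LINT \<omega>|M. iexp (v * V \<omega> $ i)) - 1) \<le> K * (1 + v\<^sup>2)" for v
      using K[of "v *\<^sub>R axis i 1"] by (simp add: inner_axis')
  qed measurable
  have "(LINT \<omega>|M. min ((norm (V \<omega>))\<^sup>2) 1) \<le> (LINT \<omega>|M. (\<Sum>i\<in>UNIV. min ((V \<omega> $ i)\<^sup>2) 1))"
    by (intro integral_mono min_square_le_sum Bochner_Integration.integrable_sum)
       (auto intro!: integrable_const_bound[where B=1])
  also have "\<dots> = (\<Sum>i\<in>UNIV. LINT \<omega>|M. min ((V \<omega> $ i)\<^sup>2) 1)"
    by (intro Bochner_Integration.integral_sum) (auto intro!: integrable_const_bound[where B=1])
  also have "\<dots> \<le> (\<Sum>i\<in>(UNIV::'n set). 8 * K)" by (intro sum_mono i)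
  finally show ?thesis by simp
qed

lemma truncated_integrable:
  fixes V :: "'a \<Rightarrow> real^'n"
  assumes [measurable]: "V \<in> borel_measurable M"
  shows "integrable M (\<lambda>\<omega>. indicator {x. norm x \<le> 1} (V \<omega>) *\<^sub>R V \<omega>)"
  by (rule integrable_const_bound[where B=1]) (auto simp: indicator_def)

lemma norm_truncated_mean_le_1:
  fixes V :: "'a \<Rightarrow> real^'n"
  assumes [measurable]: "V \<in> borel_measurable M"
  shows "norm (truncated_mean M V) \<le> 1"
proof -
  have "norm (truncated_mean M V) \<le> (LINT \<omega>|M. norm (indicator {x. norm x \<le> 1} (V \<omega>) *\<^sub>R V \<omega>))"
    unfolding truncated_mean_def by (rule integral_norm_bound)
  also have "\<dots> \<le> (LINT \<omega>|M. 1)"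
    using truncated_integrable[OF assms] by (intro integral_mono integrable_norm) (auto simp: indicator_def)
  finally show ?thesis by (simp add: prob_space)
qed

text \<open>Used twice: to bound the truncated mean by the other two terms, and to evaluate the jump
  integral of the mixture for each fixed \<open>r\<close>.\<close>

lemma expectation_levy_integrand:
  fixes V :: "'a \<Rightarrow> real^'n"
  assumes [measurable]: "V \<in> borel_measurable M"
  shows "(LINT \<omega>|M. levy_integrand u (V \<omega>))
    = (LINT \<omega>|M. iexp (u \<bullet> V \<omega>)) - 1 - \<i> * complex_of_real (u \<bullet> truncated_mean M V)"
proof -
  let ?T = "\<lambda>\<omega>. indicator {x. norm x \<le> 1} (V \<omega>) *\<^sub>R V \<omega>"
  have int: "integrable M (\<lambda>\<omega>. iexp (u \<bullet> V \<omega>))"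
    by (rule integrable_const_bound[where B=1]) auto
  have "integrable M (\<lambda>\<omega>. u \<bullet> ?T \<omega>)" "(LINT \<omega>|M. u \<bullet> ?T \<omega>) = u \<bullet> truncated_mean M V"
    using truncated_integrable[OF assms] by (simp_all add: truncated_mean_def del: inner_scaleR_right)
  then have "integrable M (\<lambda>\<omega>. \<i> * complex_of_real (u \<bullet> ?T \<omega>))"
    "(LINT \<omega>|M. \<i> * complex_of_real (u \<bullet> ?T \<omega>)) = \<i> * complex_of_real (u \<bullet> truncated_mean M V)"
    by (simp_all del: inner_scaleR_right)
  moreover have "levy_integrand u (V \<omega>) = (iexp (u \<bullet> V \<omega>) - 1) - \<i> * complex_of_real (u \<bullet> ?T \<omega>)" for \<omega>
    by (simp add: levy_integrand_def indicator_def)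
  ultimately show ?thesis
    using int by (simp add: prob_space del: inner_scaleR_right)
qed

text \<open>At a unit coordinate vector, a coordinate of the truncated mean is the difference of the
  characteristic function minus 1, at most \<open>2 * K\<close>, and the expected integrand, at most
  3 times the moment bound \<open>8 * CARD('n) * K\<close>. Summing over coordinates gives the outer
  dimension factor.\<close>

lemma norm_truncated_mean_le:
  fixes V :: "'a \<Rightarrow> real^'n" and K :: real
  assumes [measurable]: "V \<in> borel_measurable M"
    and K: "\<And>u. cmod ((LINT \<omega>|M. iexp (u \<bullet> V \<omega>)) - 1) \<le> K * (1 + (norm u)\<^sup>2)"
  shows "norm (truncated_mean M V) \<le> real CARD('n) * (2 + 24 * real CARD('n)) * K"
proof -
  have i: "\<bar>truncated_mean M V $ i\<bar> \<le> (2 + 24 * real CARD('n)) * K" for i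
  proof -
    let ?u = "axis i 1 :: real^'n"
    have int: "integrable M (\<lambda>\<omega>. min ((norm (V \<omega>))\<^sup>2) 1)"
      by (rule integrable_const_bound[where B=1]) auto
    have le: "cmod (levy_integrand ?u x) \<le> 3 * min ((norm x)\<^sup>2) 1" for x
      using cmod_levy_integrand_le[of ?u x] by simp
    have "cmod (LINT \<omega>|M. levy_integrand ?u (V \<omega>)) \<le> (LINT \<omega>|M. cmod (levy_integrand ?u (V \<omega>)))"
      by (rule integral_norm_bound)
    also have "\<dots> \<le> (LINT \<omega>|M. 3 * min ((norm (V \<omega>))\<^sup>2) 1)"
      using int by (intro integral_mono le integrable_const_bound[where B=3])
        (auto intro!: order.trans[OF le])
    also have "\<dots> \<le> 3 * (8 * real CARD('n) * K)"
      using expectation_min_norm_square_le[OF assms] int by (simp add: mult_ac)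
    finally have 1: "cmod (LINT \<omega>|M. levy_integrand ?u (V \<omega>)) \<le> 24 * real CARD('n) * K" by simp
    have "\<bar>truncated_mean M V $ i\<bar> = cmod (\<i> * complex_of_real (?u \<bullet> truncated_mean M V))"
      by (simp add: norm_mult inner_axis')
    also have "\<dots> = cmod (((LINT \<omega>|M. iexp (?u \<bullet> V \<omega>)) - 1) - (LINT \<omega>|M. levy_integrand ?u (V \<omega>)))"
      by (simp add: expectation_levy_integrand)
    also have "\<dots> \<le> K * (1 + (norm ?u)\<^sup>2) + 24 * real CARD('n) * K"
      by (intro order.trans[OF norm_triangle_ineq4] add_mono K 1)
    finally show ?thesis by (simp add: algebra_simps)
  qed
  have "norm (truncated_mean M V) \<le> (\<Sum>i\<in>UNIV. \<bar>truncated_mean M V $ i\<bar>)"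
    by (rule norm_le_l1_cart)
  also have "\<dots> \<le> (\<Sum>i\<in>(UNIV::'n set). (2 + 24 * real CARD('n)) * K)"
    by (intro sum_mono i)
  finally show ?thesis by simp
qed

end

section \<open>The characteristics of the subordinated process\<close>

lemma set_integrable_scaleR_min_bound:
  fixes f :: "real \<Rightarrow> 'b::{banach, second_countable_topology}"
  assumes g: "set_integrable lborel {0<..} (\<lambda>r. min 1 r * g r)" "\<And>r. 0 < r \<Longrightarrow> 0 \<le> g r"
    and meas: "set_borel_measurable lborel {0<..} (\<lambda>r. g r *\<^sub>R f r)"
    and f: "\<And>r. 0 < r \<Longrightarrow> norm (f r) \<le> C * min 1 r"
  shows "set_integrable lborel {0<..} (\<lambda>r. g r *\<^sub>R f r)"
  unfolding set_integrable_def
proof (rule Bochner_Integration.integrable_bound)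
  show "integrable lborel (\<lambda>r. C * (indicator {0<..} r *\<^sub>R (min 1 r * g r)))"
    using g(1) unfolding set_integrable_def by (rule integrable_mult_right)
  show "AE r in lborel. norm (indicat_real {0<..} r *\<^sub>R g r *\<^sub>R f r)
      \<le> norm (C * (indicator {0<..} r *\<^sub>R (min 1 r * g r)))"
  proof (rule AE_I2)
    fix r :: real
    have "g r * norm (f r) \<le> \<bar>C * (min 1 r * g r)\<bar>" if "0 < r"
      using mult_left_mono[OF f[OF that] g(2)[OF that]] abs_ge_self[of "C * (min 1 r * g r)"]
      by (simp add: mult_ac)
    then show "norm (indicat_real {0<..} r *\<^sub>R g r *\<^sub>R f r)
      \<le> norm (C * (indicator {0<..} r *\<^sub>R (min 1 r * g r)))"
      using g(2) by (auto simp: indicator_def)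
  qed
qed (use meas in \<open>simp add: set_borel_measurable_def\<close>)

section \<open>Small-time bounds and the characteristic function of the time change\<close>

locale subordinated_levy = time_changed_levy M X Z
  for M :: "'w measure" and X :: "real \<Rightarrow> 'w \<Rightarrow> real^'n" and Z +
  fixes c :: "real^'n" and Q :: "real^'n^'n" and \<nu> :: "(real^'n) measure"
    and \<beta> :: "real \<Rightarrow> real" and g :: "real \<Rightarrow> real \<Rightarrow> real"
  assumes triplet: "has_levy_triplet M X c Q \<nu>"
    and \<beta>_nonneg: "\<And>s. 0 \<le> s \<Longrightarrow> 0 \<le> \<beta> s"
    and g_continuous: "\<And>s. 0 \<le> s \<Longrightarrow> continuous_on {0..} (g s)"
    and g_nonneg: "\<And>s r. 0 \<le> s \<Longrightarrow> 0 \<le> r \<Longrightarrow> 0 \<le> g s r"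
    and g_integrable: "\<And>s. 0 \<le> s \<Longrightarrow> set_integrable lborel {0<..} (\<lambda>r. min 1 r * g s r)"
    and laplace: "has_laplace_exponent M Z (subordinator_exponent \<beta> g)"
begin

abbreviation \<Psi> :: "real^'n \<Rightarrow> complex" where "\<Psi> \<equiv> levy_exponent c Q \<nu>"

lemma levy_measure_\<nu>: "levy_measure \<nu>"
  and char_X: "0 \<le> t \<Longrightarrow> (LINT \<omega>|M. iexp (u \<bullet> X t \<omega>)) = exp (complex_of_real t * \<Psi> u)"
  using triplet by (auto simp: has_levy_triplet_def)

lemma Re_\<Psi>_nonpos: "Re (\<Psi> u) \<le> 0"
proof -
  have "cmod (exp (\<Psi> u)) = cmod (LINT \<omega>|M. iexp (u \<bullet> X 1 \<omega>))"
    using char_X[of 1 u] by simp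
  also have "\<dots> \<le> (LINT \<omega>|M. cmod (iexp (u \<bullet> X 1 \<omega>)))"
    by (rule integral_norm_bound)
  also have "\<dots> = 1" by (simp add: prob_space)
  finally show ?thesis by simp
qed

text \<open>The first bound, proportional to the modulus of \<open>\<Psi> u\<close>, feeds the
  moment estimates; the second, also bounded for large \<open>r\<close>, gives integrability against
  \<open>g s\<close>.\<close>

lemma cmod_char_minus_one_le:
  assumes "0 \<le> r"
  shows "cmod (exp (complex_of_real r * \<Psi> u) - 1) \<le> r * cmod (\<Psi> u)"
    and "cmod (exp (complex_of_real r * \<Psi> u) - 1) \<le> (2 + cmod (\<Psi> u)) * min 1 r"
proof -
  have Re: "Re (complex_of_real r * \<Psi> u) \<le> 0"
    using assms Re_\<Psi>_nonpos[of u] by (simp add: mult_nonneg_nonpos)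
  then show 1: "cmod (exp (complex_of_real r * \<Psi> u) - 1) \<le> r * cmod (\<Psi> u)"
    using cmod_exp_minus_one_le[OF Re] assms by (simp add: norm_mult)
  have "cmod (exp (complex_of_real r * \<Psi> u)) \<le> 1" using Re by simp
  then have 2: "cmod (exp (complex_of_real r * \<Psi> u) - 1) \<le> 2"
    using norm_triangle_ineq4[of "exp (complex_of_real r * \<Psi> u)" 1] by (simp del: norm_exp_eq_Re)
  show "cmod (exp (complex_of_real r * \<Psi> u) - 1) \<le> (2 + cmod (\<Psi> u)) * min 1 r"
  proof (cases "1 \<le> r")
    case True
    then show ?thesis using 2 by (simp add: min_absorb1 add_increasing2)
  next
    case False
    then have "r * cmod (\<Psi> u) \<le> (2 + cmod (\<Psi> u)) * min 1 r" using assms by (simp add: min_def algebra_simps)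
    with 1 show ?thesis by simp
  qed
qed

text \<open>The moment lemmas apply at time \<open>r\<close> with \<open>K\<close> replaced by
  \<open>r * K\<close>, giving order \<open>r\<close>; for \<open>r \<ge> 1\<close> the trivial
  bound 1 takes over.\<close>

lemma small_time_bounds:
  obtains C where "0 \<le> C"
    "\<And>r. 0 \<le> r \<Longrightarrow> (LINT \<omega>|M. min ((norm (X r \<omega>))\<^sup>2) 1) \<le> C * min 1 r"
    "\<And>r. 0 \<le> r \<Longrightarrow> norm (truncated_mean M (X r)) \<le> C * min 1 r"
proof -
  obtain K where K: "0 \<le> K" "\<And>u. cmod (\<Psi> u) \<le> K * (1 + (norm u)\<^sup>2)"
    using levy_exponent_quadratic_bound[OF levy_measure_\<nu>] by blast
  have char: "cmod ((LINT \<omega>|M. iexp (u \<bullet> X r \<omega>)) - 1) \<le> (r * K) * (1 + (norm u)\<^sup>2)" if "0 \<le> r" for r u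
    using cmod_char_minus_one_le(1)[OF that, of u] mult_left_mono[OF K(2) that, of u] char_X[OF that]
    by (simp add: mult_ac)
  define N where "N = real CARD('n)"
  \<comment> \<open>The sum dominates the trivial bound and the constants of both moment lemmas, so
    one \<open>C\<close> serves both conclusions.\<close>
  define C where "C = 1 + 8 * N * K + N * (2 + 24 * N) * K"
  have N: "0 \<le> N" by (simp add: N_def)
  have bound: "x \<le> C * min 1 r" if "x \<le> 1" "x \<le> a * (r * K)" "0 \<le> r" "a * K \<le> C" "1 \<le> C" for x a r
  proof (cases "1 \<le> r")
    case False
    have "a * (r * K) \<le> C * r" using mult_right_mono[OF that(4,3)] by (simp add: mult_ac)
    then show ?thesis using False that by simp
  qed (use that in simp)
  have C: "8 * N * K \<le> C" "N * (2 + 24 * N) * K \<le> C" "1 \<le> C"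
    using N K(1) by (simp_all add: C_def)
  show ?thesis
  proof (rule that)
    fix r :: real assume r: "0 \<le> r"
    have [measurable]: "X r \<in> borel_measurable M" using r by (rule X_measurable)
    have "(LINT \<omega>|M. min ((norm (X r \<omega>))\<^sup>2) 1) \<le> (LINT \<omega>|M. 1)"
      by (intro integral_mono integrable_const_bound[where B=1]) auto
    then show "(LINT \<omega>|M. min ((norm (X r \<omega>))\<^sup>2) 1) \<le> C * min 1 r"
      using expectation_min_norm_square_le[OF _ char[OF r]] C r
      by (intro bound[of _ "8 * N"]) (auto simp: prob_space N_def)
    show "norm (truncated_mean M (X r)) \<le> C * min 1 r"
      using norm_truncated_mean_le[OF _ char[OF r]] norm_truncated_mean_le_1[of "X r"] C r
      by (intro bound[of _ "N * (2 + 24 * N)"]) (auto simp: N_def)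
  qed (use C in simp)
qed

lemma char_time_change:
  assumes t: "0 \<le> t"
  shows "set_integrable lborel {0..t} (\<lambda>s. subordinator_exponent \<beta> g s (- \<Psi> u))"
    and "(LINT \<omega>|M. iexp (u \<bullet> time_change X Z t \<omega>))
      = exp (LINT s:{0..t}|lborel. subordinator_exponent \<beta> g s (- \<Psi> u))"
proof -
  have "0 \<le> Re (- \<Psi> u)" using Re_\<Psi>_nonpos[of u] by simp
  with laplace t have L: "set_integrable lborel {0..t} (\<lambda>s. subordinator_exponent \<beta> g s (- \<Psi> u))"
    "(LINT \<omega>|M. exp (- (- \<Psi> u) * complex_of_real (Z t \<omega>)))
      = exp (LINT s:{0..t}|lborel. subordinator_exponent \<beta> g s (- \<Psi> u))"
    unfolding has_laplace_exponent_def by blast+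
  show "set_integrable lborel {0..t} (\<lambda>s. subordinator_exponent \<beta> g s (- \<Psi> u))" by fact
  have "(LINT \<omega>|M. iexp (u \<bullet> time_change X Z t \<omega>)) = (LINT \<omega>'|M. LINT \<omega>|M. iexp (u \<bullet> X (Z t \<omega>') \<omega>))"
    by (rule integral_time_change[OF t, where B=1 and f="\<lambda>x. iexp (u \<bullet> x)"]) auto
  \<comment> \<open>The double negation is kept to match the Laplace transform at the point
    \<open>- \<Psi> u\<close>.\<close>
  also have "\<dots> = (LINT \<omega>'|M. exp (- (- \<Psi> u) * complex_of_real (Z t \<omega>')))"
    by (intro Bochner_Integration.integral_cong refl) (simp add: char_X Z_nonneg t mult.commute)
  finally show "(LINT \<omega>|M. iexp (u \<bullet> time_change X Z t \<omega>))
      = exp (LINT s:{0..t}|lborel. subordinator_exponent \<beta> g s (- \<Psi> u))"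
    unfolding L(2) .
qed

text \<open>\<open>g s\<close> is constrained only at nonnegative arguments; cutting it off gives a
  density that is measurable and nonnegative on the whole line.\<close>

definition weight :: "real \<Rightarrow> real \<Rightarrow> real" where "weight s r = indicator {0<..} r * g s r"

lemma weight_nonneg: "0 \<le> s \<Longrightarrow> 0 \<le> weight s r"
  using g_nonneg by (simp add: weight_def indicator_def)

lemma weight_measurable [measurable]:
  assumes "0 \<le> s"
  shows "weight s \<in> borel_measurable borel"
proof -
  have "(\<lambda>r. indicator {0<..} r *\<^sub>R g s r) \<in> borel_measurable borel"
    using g_continuous[OF assms] by (intro borel_measurable_continuous_on_indicator) (auto intro: continuous_on_subset)
  then show ?thesis by (simp add: weight_def[abs_def])
qed

lemma weight_scaleR_eq:
  fixes f :: "('w \<Rightarrow> real^'n) \<Rightarrow> 'c::real_vector"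
  shows "weight s r *\<^sub>R f (flow r) = indicator {0<..} r *\<^sub>R (g s r *\<^sub>R f (X r))"
  by (simp add: weight_def indicator_def flow_eq)

lemma truncated_mean_flow_measurable [measurable]: "(\<lambda>r. truncated_mean M (flow r)) \<in> borel_measurable borel"
  unfolding truncated_mean_def by measurable

lemma truncated_mean_set_integrable:
  assumes s: "0 \<le> s"
  shows "set_integrable lborel {0<..} (\<lambda>r. g s r *\<^sub>R truncated_mean M (X r))"
proof -
  obtain C where C: "\<And>r. 0 \<le> r \<Longrightarrow> norm (truncated_mean M (X r)) \<le> C * min 1 r"
    using small_time_bounds by metis
  note [measurable] = weight_measurable[OF s]
  have "(\<lambda>r. weight s r *\<^sub>R truncated_mean M (flow r)) \<in> borel_measurable lborel" by measurable
  then have "set_borel_measurable lborel {0<..} (\<lambda>r. g s r *\<^sub>R truncated_mean M (X r))"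
    unfolding set_borel_measurable_def weight_scaleR_eq[of s _ "truncated_mean M"] .
  with g_integrable[OF s] show ?thesis
    using C g_nonneg[OF s] by (intro set_integrable_scaleR_min_bound[where C=C]) auto
qed

lemma exp_set_integrable:
  assumes s: "0 \<le> s"
  shows "set_integrable lborel {0<..} (\<lambda>r. g s r *\<^sub>R (exp (complex_of_real r * \<Psi> u) - 1))"
proof (rule set_integrable_scaleR_min_bound[where C="2 + cmod (\<Psi> u)"])
  note [measurable] = weight_measurable[OF s]
  have "(\<lambda>r. weight s r *\<^sub>R (exp (complex_of_real r * \<Psi> u) - 1)) \<in> borel_measurable lborel" by measurable
  then show "set_borel_measurable lborel {0<..} (\<lambda>r. g s r *\<^sub>R (exp (complex_of_real r * \<Psi> u) - 1))"
    unfolding set_borel_measurable_def by (simp add: weight_def mult.assoc scaleR_scaleR[symmetric] del: scaleR_scaleR)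
qed (use g_integrable g_nonneg cmod_char_minus_one_le(2) s in auto)

section \<open>The mixture of the laws of \<open>X r\<close> as an image measure\<close>

definition occupation :: "real \<Rightarrow> (real \<times> 'w) measure" where
  "occupation s = density (lborel \<Otimes>\<^sub>M M) (\<lambda>p. ennreal (weight s (fst p)))"

text \<open>The integral of the laws of \<open>X r\<close> against \<open>g s r dr\<close>, away
  from the origin. As the image of a weighted product measure under the flow it is countably
  additive by construction, and integrals against it reduce to double integrals.\<close>

definition mixture :: "real \<Rightarrow> (real^'n) measure" where
  "mixture s = restrict_space (distr (occupation s) borel (case_prod flow)) (- {0})"

lemma sets_mixture: "sets (mixture s) = sets punctured_borel"
  unfolding mixture_def by (simp add: sets_restrict_space)

lemma flow_measurable_product [measurable]: "case_prod flow \<in> borel_measurable (lborel \<Otimes>\<^sub>M M)"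
proof -
  have "(\<lambda>p. flow (fst p) (snd p)) \<in> borel_measurable (lborel \<Otimes>\<^sub>M M)" by measurable
  then show ?thesis by (simp add: case_prod_beta')
qed

text \<open>Vanishing of \<open>f\<close> at 0 makes the removal of the origin invisible; what
  remains is change of variables, the density formula and Tonelli.\<close>

lemma nn_integral_mixture:
  assumes s: "0 \<le> s" and [measurable]: "f \<in> borel_measurable borel" and f0: "f 0 = 0"
  shows "(\<integral>\<^sup>+x. f x \<partial>mixture s) = (\<integral>\<^sup>+r. ennreal (weight s r) * (\<integral>\<^sup>+\<omega>. f (flow r \<omega>) \<partial>M) \<partial>lborel)"
proof -
  note [measurable] = weight_measurable[OF s]
  have "(\<integral>\<^sup>+x. f x \<partial>mixture s) = (\<integral>\<^sup>+x. f x * indicator (- {0}) x \<partial>distr (occupation s) borel (case_prod flow))"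
    unfolding mixture_def by (intro nn_integral_restrict_space) auto
  also have "\<dots> = (\<integral>\<^sup>+x. f x \<partial>distr (occupation s) borel (case_prod flow))"
    using f0 by (intro nn_integral_cong) (auto simp: indicator_def)
  also have "\<dots> = (\<integral>\<^sup>+p. f (case_prod flow p) \<partial>occupation s)"
    by (intro nn_integral_distr) (auto simp: occupation_def)
  also have "\<dots> = (\<integral>\<^sup>+p. ennreal (weight s (fst p)) * f (case_prod flow p) \<partial>(lborel \<Otimes>\<^sub>M M))"
    unfolding occupation_def by (intro nn_integral_density) auto
  also have "\<dots> = (\<integral>\<^sup>+r. \<integral>\<^sup>+\<omega>. ennreal (weight s r) * f (flow r \<omega>) \<partial>M \<partial>lborel)"
    by (subst nn_integral_fst[symmetric]) (auto simp: case_prod_beta')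
  finally show ?thesis by (simp add: nn_integral_cmult)
qed

lemma emeasure_mixture:
  assumes s: "0 \<le> s" and A: "A \<in> sets punctured_borel"
  shows "emeasure (mixture s) A
    = (\<integral>\<^sup>+ r\<in>{0<..}. emeasure M {\<omega> \<in> space M. X r \<omega> \<in> A} * ennreal (g s r) \<partial>lborel)"
proof -
  have A': "A \<in> sets borel" "0 \<notin> A" using A by (auto simp: sets_restrict_space)
  have "emeasure (mixture s) A = (\<integral>\<^sup>+x. indicator A x \<partial>mixture s)"
    using A by (simp add: sets_mixture)
  also have "\<dots> = (\<integral>\<^sup>+r. ennreal (weight s r) * (\<integral>\<^sup>+\<omega>. indicator A (flow r \<omega>) \<partial>M) \<partial>lborel)"
    using A' by (intro nn_integral_mixture s) auto
  also have "\<dots> = (\<integral>\<^sup>+ r. emeasure M {\<omega> \<in> space M. X r \<omega> \<in> A} * ennreal (g s r) * indicator {0<..} r \<partial>lborel)"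
  proof (intro nn_integral_cong)
    fix r :: real
    show "ennreal (weight s r) * (\<integral>\<^sup>+\<omega>. indicator A (flow r \<omega>) \<partial>M)
      = emeasure M {\<omega> \<in> space M. X r \<omega> \<in> A} * ennreal (g s r) * indicator {0<..} r"
    proof (cases "0 < r")
      case True
      have [measurable]: "X r \<in> borel_measurable M" using True by (intro X_measurable) simp
      have "(\<integral>\<^sup>+\<omega>. indicator A (X r \<omega>) \<partial>M) = (\<integral>\<^sup>+\<omega>. indicator {\<omega> \<in> space M. X r \<omega> \<in> A} \<omega> \<partial>M)"
        by (intro nn_integral_cong) (auto simp: indicator_def)
      also have "\<dots> = emeasure M {\<omega> \<in> space M. X r \<omega> \<in> A}"
        using measurable_sets[OF \<open>X r \<in> borel_measurable M\<close> A'(1)]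
        by (intro nn_integral_indicator) (simp add: vimage_def Int_def conj_commute)
      finally show ?thesis using True by (simp add: weight_def flow_eq mult.commute)
    qed (simp add: weight_def)
  qed
  finally show ?thesis .
qed

section \<open>The jump measure as the sum of a scaled Levy measure and the mixture\<close>

abbreviation jump :: "real \<Rightarrow> (real^'n) measure" where
  "jump s \<equiv> subordinate_jump_measure M X \<nu> \<beta> g s"

abbreviation scaled :: "real \<Rightarrow> (real^'n) measure" where
  "scaled s \<equiv> density \<nu> (\<lambda>_. ennreal (\<beta> s))"

lemma sets_\<nu>: "sets \<nu> = sets punctured_borel"
  using levy_measure_\<nu> by (simp add: levy_measure_def)

lemma sigma_algebra_punctured: "sigma_algebra (- {0}) (sets (punctured_borel :: (real^'n) measure))"
  using sets.sigma_algebra_axioms[of "punctured_borel :: (real^'n) measure"] by (simp add: space_restrict_space)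

lemma sets_jump: "sets (jump s) = sets punctured_borel"
  unfolding subordinate_jump_measure_def
  by (rule sigma_algebra.sets_measure_of_eq[OF sigma_algebra_punctured])

lemma subordinate_mass_eq:
  assumes "0 \<le> s" "A \<in> sets punctured_borel"
  shows "subordinate_mass M X \<nu> \<beta> g s A = emeasure (scaled s) A + emeasure (mixture s) A"
  using assms by (simp add: subordinate_mass_def emeasure_mixture emeasure_density_const sets_\<nu>)

text \<open>On Borel sets avoiding 0 the set function is the sum of the genuine measures
  \<open>scaled s\<close> and \<open>mixture s\<close>, hence countably additive, so
  \<open>measure_of\<close> does not collapse.\<close>

lemma emeasure_jump:
  assumes s: "0 \<le> s" and A: "A \<in> sets punctured_borel"
  shows "emeasure (jump s) A = subordinate_mass M X \<nu> \<beta> g s A"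
  unfolding subordinate_jump_measure_def
proof (rule emeasure_measure_of_sigma[OF sigma_algebra_punctured _ _ A])
  show "positive (sets punctured_borel) (subordinate_mass M X \<nu> \<beta> g s)"
    by (simp add: positive_def subordinate_mass_def)
  show "countably_additive (sets punctured_borel) (subordinate_mass M X \<nu> \<beta> g s)"
  proof (rule countably_additiveI)
    fix B :: "nat \<Rightarrow> (real^'n) set"
    assume B: "range B \<subseteq> sets punctured_borel" "disjoint_family B" "\<Union> (range B) \<in> sets punctured_borel"
    then show "(\<Sum>i. subordinate_mass M X \<nu> \<beta> g s (B i)) = subordinate_mass M X \<nu> \<beta> g s (\<Union> (range B))"
      using suminf_emeasure[of B "scaled s"] suminf_emeasure[of B "mixture s"]
      by (simp add: subordinate_mass_eq s range_subsetD suminf_add[symmetric] sets_mixture sets_\<nu>)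
  qed
qed

lemma emeasure_jump_add:
  "0 \<le> s \<Longrightarrow> A \<in> sets (jump s) \<Longrightarrow> emeasure (jump s) A = emeasure (scaled s) A + emeasure (mixture s) A"
  by (simp add: sets_jump emeasure_jump subordinate_mass_eq)

lemma levy_measure_scaled: "levy_measure (scaled s)"
proof -
  have [measurable]: "(\<lambda>x. min ((norm x)\<^sup>2) 1) \<in> borel_measurable \<nu>"
    using levy_measure_integrable[OF levy_measure_\<nu>] by (rule borel_measurable_integrable)
  have "(\<integral>\<^sup>+x. ennreal (min ((norm x)\<^sup>2) 1) \<partial>scaled s) = ennreal (\<beta> s) * (\<integral>\<^sup>+x. ennreal (min ((norm x)\<^sup>2) 1) \<partial>\<nu>)"
    by (subst nn_integral_density) (auto intro!: nn_integral_cmult)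
  then show ?thesis
    using levy_measure_\<nu> by (simp add: levy_measure_def ennreal_mult_less_top)
qed

text \<open>The truncated second moment of \<open>X r\<close> is at most \<open>C * min 1 r\<close>,
  and \<open>min 1 r\<close> is integrable against \<open>g s\<close>.\<close>

lemma levy_measure_mixture:
  assumes s: "0 \<le> s"
  shows "levy_measure (mixture s)"
proof -
  obtain C where C: "0 \<le> C" "\<And>r. 0 \<le> r \<Longrightarrow> (LINT \<omega>|M. min ((norm (X r \<omega>))\<^sup>2) 1) \<le> C * min 1 r"
    using small_time_bounds by metis
  have int: "integrable lborel (\<lambda>r. C * (indicator {0<..} r *\<^sub>R (min 1 r * g s r)))"
    using g_integrable[OF s] unfolding set_integrable_def by (rule integrable_mult_right)
  have "(\<integral>\<^sup>+x. ennreal (min ((norm x)\<^sup>2) 1) \<partial>mixture s)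
      = (\<integral>\<^sup>+r. ennreal (weight s r) * (\<integral>\<^sup>+\<omega>. ennreal (min ((norm (flow r \<omega>))\<^sup>2) 1) \<partial>M) \<partial>lborel)"
    by (intro nn_integral_mixture s) auto
  also have "\<dots> \<le> (\<integral>\<^sup>+r. ennreal (C * (indicator {0<..} r *\<^sub>R (min 1 r * g s r))) \<partial>lborel)"
  proof (intro nn_integral_mono)
    fix r :: real
    show "ennreal (weight s r) * (\<integral>\<^sup>+\<omega>. ennreal (min ((norm (flow r \<omega>))\<^sup>2) 1) \<partial>M)
      \<le> ennreal (C * (indicator {0<..} r *\<^sub>R (min 1 r * g s r)))"
    proof (cases "0 < r")
      case True
      have [measurable]: "X r \<in> borel_measurable M" using True by (intro X_measurable) simp
      have "(\<integral>\<^sup>+\<omega>. ennreal (min ((norm (X r \<omega>))\<^sup>2) 1) \<partial>M) = ennreal (LINT \<omega>|M. min ((norm (X r \<omega>))\<^sup>2) 1)"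
        by (intro nn_integral_eq_integral integrable_const_bound[where B=1]) auto
      also have "\<dots> \<le> ennreal (C * min 1 r)" using C True by (intro ennreal_leI) auto
      finally have "ennreal (g s r) * (\<integral>\<^sup>+\<omega>. ennreal (min ((norm (X r \<omega>))\<^sup>2) 1) \<partial>M) \<le> ennreal (g s r) * ennreal (C * min 1 r)"
        by (rule mult_left_mono) simp
      also have "\<dots> = ennreal (C * (min 1 r * g s r))"
        using True C g_nonneg[OF s, of r] by (subst ennreal_mult[symmetric]) (auto simp: mult_ac)
      finally show ?thesis using True by (simp add: weight_def flow_eq)
    qed (simp add: weight_def)
  qed
  also have "\<dots> < \<infinity>"
    by (subst nn_integral_eq_integral[OF int]) (use C g_nonneg[OF s] in \<open>auto simp: indicator_def\<close>)
  finally show ?thesis by (simp add: levy_measure_def sets_mixture)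
qed

lemma levy_measure_jump:
  assumes s: "0 \<le> s"
  shows "levy_measure (jump s)"
proof -
  have "(\<lambda>x::real^'n. ennreal (min ((norm x)\<^sup>2) 1)) \<in> borel_measurable (jump s)"
    using levy_measure_borel_measurable[OF levy_measure_\<nu>, of "\<lambda>x. ennreal (min ((norm x)\<^sup>2) 1)"]
    by (simp add: measurable_cong_sets[OF sets_jump refl] measurable_cong_sets[OF sets_\<nu> refl])
  then have "(\<integral>\<^sup>+x. ennreal (min ((norm x)\<^sup>2) 1) \<partial>jump s)
    = (\<integral>\<^sup>+x. ennreal (min ((norm x)\<^sup>2) 1) \<partial>scaled s) + (\<integral>\<^sup>+x. ennreal (min ((norm x)\<^sup>2) 1) \<partial>mixture s)"
    by (intro nn_integral_measure_add emeasure_jump_add s) (simp_all add: sets_\<nu> sets_jump sets_mixture)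
  then show ?thesis
    using levy_measure_scaled[of s] levy_measure_mixture[OF s] by (simp add: levy_measure_def sets_jump)
qed

lemma integral_mixture:
  assumes s: "0 \<le> s"
  shows "(LINT x|mixture s. levy_integrand u x)
    = (LINT r:{0<..}|lborel. g s r *\<^sub>R (exp (complex_of_real r * \<Psi> u) - 1))
      - \<i> * complex_of_real (u \<bullet> (LINT r:{0<..}|lborel. g s r *\<^sub>R truncated_mean M (X r)))"
proof -
  interpret P: pair_sigma_finite lborel M ..
  note [measurable] = weight_measurable[OF s]
  have ind: "indicator (- {0}) x *\<^sub>R levy_integrand u x = levy_integrand u x" for x
    by (cases "x = 0") auto
  have dens: "occupation s = density (lborel \<Otimes>\<^sub>M M) (\<lambda>p. ennreal (weight s (fst p)))" by (rule occupation_def)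
  have flow_occ: "case_prod flow \<in> borel_measurable (occupation s)" by (simp add: occupation_def)
  \<comment> \<open>Integrability under the Levy measure \<open>mixture s\<close> is carried back
    through restriction, image and density to the product space, where it justifies Fubini.\<close>
  have "integrable (mixture s) (levy_integrand u)"
    by (rule levy_integrand_integrable[OF levy_measure_mixture[OF s]])
  then have "integrable (distr (occupation s) borel (case_prod flow)) (levy_integrand u)"
    unfolding mixture_def by (subst (asm) integrable_restrict_space) (auto simp: ind)
  then have "integrable (occupation s) (\<lambda>p. levy_integrand u (case_prod flow p))"
    by (subst (asm) integrable_distr_eq[OF flow_occ]) auto
  then have int: "integrable (lborel \<Otimes>\<^sub>M M) (\<lambda>p. weight s (fst p) *\<^sub>R levy_integrand u (case_prod flow p))"
    unfolding dens by (subst (asm) integrable_density) (auto simp: weight_nonneg s)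
  have "(LINT x|mixture s. levy_integrand u x) = (LINT x|(distr (occupation s) borel (case_prod flow)). levy_integrand u x)"
    unfolding mixture_def by (subst integral_restrict_space) (auto simp: ind)
  also have "\<dots> = (LINT p|occupation s. levy_integrand u (case_prod flow p))"
    by (subst integral_distr[OF flow_occ]) auto
  also have "\<dots> = (LINT p|(lborel \<Otimes>\<^sub>M M). weight s (fst p) *\<^sub>R levy_integrand u (case_prod flow p))"
    unfolding dens by (subst integral_density) (auto simp: weight_nonneg s)
  also have "\<dots> = (LINT r|lborel. LINT \<omega>|M. weight s r *\<^sub>R levy_integrand u (flow r \<omega>))"
    using P.integral_fst'[OF int] by simp
  also have "\<dots> = (LINT r|lborel. indicator {0<..} r *\<^sub>R (g s r *\<^sub>R (exp (complex_of_real r * \<Psi> u) - 1))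
      - \<i> * complex_of_real (u \<bullet> (indicator {0<..} r *\<^sub>R (g s r *\<^sub>R truncated_mean M (X r)))))"
  proof (intro Bochner_Integration.integral_cong refl)
    fix r :: real
    show "(LINT \<omega>|M. weight s r *\<^sub>R levy_integrand u (flow r \<omega>))
      = indicator {0<..} r *\<^sub>R (g s r *\<^sub>R (exp (complex_of_real r * \<Psi> u) - 1))
      - \<i> * complex_of_real (u \<bullet> (indicator {0<..} r *\<^sub>R (g s r *\<^sub>R truncated_mean M (X r))))"
    proof (cases "0 < r")
      case True
      then have "(LINT \<omega>|M. levy_integrand u (X r \<omega>))
        = exp (complex_of_real r * \<Psi> u) - 1 - \<i> * complex_of_real (u \<bullet> truncated_mean M (X r))"
        using expectation_levy_integrand[OF X_measurable, of r u] char_X[of r u] by simp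
      with True show ?thesis
        by (simp add: weight_def flow_eq scaleR_conv_of_real[where 'a=complex] right_diff_distrib)
    qed (simp add: weight_def)
  qed
  also have "\<dots> = (LINT r:{0<..}|lborel. g s r *\<^sub>R (exp (complex_of_real r * \<Psi> u) - 1))
      - (LINT r|lborel. \<i> * complex_of_real (u \<bullet> (indicator {0<..} r *\<^sub>R (g s r *\<^sub>R truncated_mean M (X r)))))"
    unfolding set_lebesgue_integral_def
    using exp_set_integrable[OF s] truncated_mean_set_integrable[OF s]
    by (intro Bochner_Integration.integral_diff integrable_mult_right integrable_of_real integrable_inner_right)
       (simp_all add: set_integrable_def)
  also have "(LINT r|lborel. \<i> * complex_of_real (u \<bullet> (indicator {0<..} r *\<^sub>R (g s r *\<^sub>R truncated_mean M (X r)))))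
      = \<i> * complex_of_real (u \<bullet> (LINT r:{0<..}|lborel. g s r *\<^sub>R truncated_mean M (X r)))"
    using truncated_mean_set_integrable[OF s]
    by (simp add: set_integrable_def set_lebesgue_integral_def del: inner_scaleR_right scaleR_scaleR)
  finally show ?thesis .
qed

text \<open>The compensator in the jump integral of the mixture contributes minus the truncated-mean
  term that \<open>subordinate_drift\<close> adds, so the two cancel. What survives is
  \<open>\<beta> s\<close> times \<open>\<Psi> u\<close> plus the integral of
  \<open>exp (r * \<Psi> u) - 1\<close> against \<open>g s\<close>.\<close>

lemma levy_exponent_subordinate:
  assumes s: "0 \<le> s"
  shows "levy_exponent (subordinate_drift M X c \<beta> g s) (\<beta> s *\<^sub>R Q) (jump s) u
    = subordinator_exponent \<beta> g s (- \<Psi> u)"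
proof -
  define I e T where "I = (LINT x|\<nu>. levy_integrand u x)"
    and "e = (LINT r:{0<..}|lborel. g s r *\<^sub>R (exp (complex_of_real r * \<Psi> u) - 1))"
    and "T = (LINT r:{0<..}|lborel. g s r *\<^sub>R truncated_mean M (X r))"
  have "(LINT x|jump s. levy_integrand u x) = (LINT x|scaled s. levy_integrand u x) + (LINT x|mixture s. levy_integrand u x)"
    using levy_measure_scaled[of s] levy_measure_mixture[OF s]
    by (intro integral_measure_add emeasure_jump_add s levy_integrand_integrable)
       (simp_all add: sets_\<nu> sets_jump sets_mixture)
  moreover have "(LINT x|scaled s. levy_integrand u x) = \<beta> s *\<^sub>R I"
    using levy_measure_borel_measurable[OF levy_measure_\<nu> levy_integrand_measurable[of u]] \<beta>_nonneg[OF s]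
    unfolding I_def by (subst integral_density) auto
  moreover have "(LINT x|mixture s. levy_integrand u x) = e - \<i> * complex_of_real (u \<bullet> T)"
    unfolding e_def T_def by (rule integral_mixture[OF s])
  ultimately have "levy_exponent (subordinate_drift M X c \<beta> g s) (\<beta> s *\<^sub>R Q) (jump s) u
      = \<i> * complex_of_real (u \<bullet> (\<beta> s *\<^sub>R c + T)) - 1/2 * complex_of_real (u \<bullet> ((\<beta> s *\<^sub>R Q) *v u))
        + (\<beta> s *\<^sub>R I + (e - \<i> * complex_of_real (u \<bullet> T)))"
    by (simp only: levy_exponent_altdef subordinate_drift_def T_def)
  also have "\<dots> = complex_of_real (\<beta> s) * (\<i> * complex_of_real (u \<bullet> c) - 1/2 * complex_of_real (u \<bullet> (Q *v u)) + I) + e"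
    by (simp add: inner_add_right scaleR_matrix_vector_assoc[symmetric] scaleR_conv_of_real[where 'a=complex] algebra_simps)
  also have "\<dots> = - (- \<Psi> u) * complex_of_real (\<beta> s) + e"
    unfolding levy_exponent_altdef I_def by (simp only: minus_minus mult.commute)
  also have "e = (LINT r:{0<..}|lborel. (exp (- (- \<Psi> u) * complex_of_real r) - 1) * complex_of_real (g s r))"
    unfolding e_def scaleR_conv_of_real by (simp only: minus_minus mult.commute)
  finally show ?thesis
    unfolding subordinator_exponent_def .
qed

lemma has_characteristic_exponent_time_change:
  "has_characteristic_exponent M (time_change X Z)
    (\<lambda>s. levy_exponent (subordinate_drift M X c \<beta> g s) (\<beta> s *\<^sub>R Q) (jump s))"
  unfolding has_characteristic_exponent_def
proof (intro allI impI)
  fix t :: real and u :: "real^'n" assume t: "0 \<le> t"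
  have eq: "levy_exponent (subordinate_drift M X c \<beta> g s) (\<beta> s *\<^sub>R Q) (jump s) u
      = subordinator_exponent \<beta> g s (- \<Psi> u)" if "s \<in> {0..t}" for s
    using that by (intro levy_exponent_subordinate) simp
  show "set_integrable lborel {0..t} (\<lambda>s. levy_exponent (subordinate_drift M X c \<beta> g s) (\<beta> s *\<^sub>R Q) (jump s) u)
    \<and> (LINT \<omega>|M. iexp (u \<bullet> time_change X Z t \<omega>))
      = exp (LINT s:{0..t}|lborel. levy_exponent (subordinate_drift M X c \<beta> g s) (\<beta> s *\<^sub>R Q) (jump s) u)"
  proof (intro conjI)
    show "set_integrable lborel {0..t} (\<lambda>s. levy_exponent (subordinate_drift M X c \<beta> g s) (\<beta> s *\<^sub>R Q) (jump s) u)"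
      using char_time_change(1)[OF t, of u] by (rule set_integrable_cong[THEN iffD1, rotated -1]) (simp_all add: eq)
    have "(LINT s:{0..t}|lborel. levy_exponent (subordinate_drift M X c \<beta> g s) (\<beta> s *\<^sub>R Q) (jump s) u)
        = (LINT s:{0..t}|lborel. subordinator_exponent \<beta> g s (- \<Psi> u))"
      by (intro set_lebesgue_integral_cong) (simp_all add: eq)
    then show "(LINT \<omega>|M. iexp (u \<bullet> time_change X Z t \<omega>))
      = exp (LINT s:{0..t}|lborel. levy_exponent (subordinate_drift M X c \<beta> g s) (\<beta> s *\<^sub>R Q) (jump s) u)"
      using char_time_change(2)[OF t, of u] by simp
  qed
qed

end

lemma nonneg_symmetric_scaleR:
  assumes "nonneg_symmetric Q" "0 \<le> b"
  shows "nonneg_symmetric (b *\<^sub>R Q)"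
proof -
  have "transpose (b *\<^sub>R Q) = b *\<^sub>R transpose Q" by (simp add: transpose_def vec_eq_iff)
  with assms show ?thesis by (simp add: nonneg_symmetric_def scaleR_matrix_vector_assoc[symmetric])
qed

text \<open>The clauses on \<open>emeasure\<close> and \<open>set_integrable\<close> certify that
  the jump measure and the drift are the intended objects and not the default value 0 of
  \<open>measure_of\<close> or of the Bochner integral.\<close>

theorem proposition1:
  fixes M :: "'w measure"
    and X :: "real \<Rightarrow> 'w \<Rightarrow> real^'n"
    and Z :: "real \<Rightarrow> 'w \<Rightarrow> real"
    and c :: "real^'n"
    and Q :: "real^'n^'n"
    and \<nu> :: "(real^'n) measure"
    and \<beta> :: "real \<Rightarrow> real"
    and g :: "real \<Rightarrow> real \<Rightarrow> real"
  assumes "prob_space M"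
    and "levy_process M X"
    and "has_levy_triplet M X c Q \<nu>"
    and "additive_subordinator M Z"
    and "independent_processes M X Z"
    and "continuous_on {0..} \<beta>"
    and "\<And>s. 0 \<le> s \<Longrightarrow> 0 \<le> \<beta> s"
    and "continuous_on ({0..} \<times> {0..}) (\<lambda>(s, r). g s r)"
    and "\<And>s r. 0 \<le> s \<Longrightarrow> 0 \<le> r \<Longrightarrow> 0 \<le> g s r"
    and "\<And>s. 0 \<le> s \<Longrightarrow> set_integrable lborel {0<..} (\<lambda>r. min 1 r * g s r)"
    and "has_laplace_exponent M Z (subordinator_exponent \<beta> g)"
  shows "additive_process M (time_change X Z)
    \<and> (\<forall>s\<ge>0.
          levy_measure (subordinate_jump_measure M X \<nu> \<beta> g s)
        \<and> (\<forall>A\<in>sets punctured_borel.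
             emeasure (subordinate_jump_measure M X \<nu> \<beta> g s) A = subordinate_mass M X \<nu> \<beta> g s A)
        \<and> nonneg_symmetric (\<beta> s *\<^sub>R Q)
        \<and> set_integrable lborel {0<..} (\<lambda>r. g s r *\<^sub>R truncated_mean M (X r)))
    \<and> has_characteristic_exponent M (time_change X Z)
        (\<lambda>s. levy_exponent (subordinate_drift M X c \<beta> g s) (\<beta> s *\<^sub>R Q)
               (subordinate_jump_measure M X \<nu> \<beta> g s))"
proof -
  have cont: "continuous_on {0..} (g s)" if "0 \<le> s" for s
  proof -
    have "continuous_on {0..} (\<lambda>r. case (s, r) of (s, r) \<Rightarrow> g s r)"
      by (rule continuous_on_compose2[OF assms(8)]) (use that in \<open>auto intro: continuous_on_Pair[OF continuous_on_const continuous_on_id]\<close>)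
    then show ?thesis by simp
  qed
  interpret prob_space M by fact
  interpret subordinated_levy M X Z c Q \<nu> \<beta> g
    by unfold_locales (use assms cont in auto)
  have "nonneg_symmetric Q" using triplet by (simp add: has_levy_triplet_def)
  then show ?thesis
    using time_change_additive levy_measure_jump emeasure_jump truncated_mean_set_integrable
      has_characteristic_exponent_time_change nonneg_symmetric_scaleR \<beta>_nonneg by blast
qed

end
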